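(* Let $\mathbf G$ be a torsion-free group, and let $\mathbf H$ be a group such that $\mathcal G(\mathbf G)\cong\mathcal G(\mathbf H)$ (isomorphic power graphs). Then $\vec{\mathcal G}(\mathbf G)\cong\vec{\mathcal G}(\mathbf H)$ (isomorphic directed power graphs).
   Context: For a group $\mathbf G$ with underlying set $G$: the directed power graph $\vec{\mathcal G}(\mathbf G)$ is the simple digraph with vertex set $G$ in which there is an arc from $x$ to $y$, $x\neq y$, if and only if $y=x^n$ for some $n\in\mathbb Z$. The power graph $\mathcal G(\mathbf G)$ is the simple graph with vertex set $G$ in which $x\neq y$ are adjacent if and only if there is $n\in\mathbb Z$ with $y=x^n$ or $x=y^n$. *)

theory Defs
  imports "HOL-Algebra.Group" "Graph_Theory.Digraph_Isomorphism"
begin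

definition torsion_free :: "('a, 'm) monoid_scheme \<Rightarrow> bool" where
  "torsion_free G \<longleftrightarrow>
    (\<forall>x \<in> carrier G. \<forall>n::nat. n > 0 \<longrightarrow> x [^]\<^bsub>G\<^esub> n = \<one>\<^bsub>G\<^esub> \<longrightarrow> x = \<one>\<^bsub>G\<^esub>)"

definition directed_power_graph :: "('a, 'm) monoid_scheme \<Rightarrow> 'a pair_pre_digraph" where
  "directed_power_graph G =
    \<lparr> pverts = carrier G,
      parcs = {(x, y). x \<in> carrier G \<and> y \<in> carrier G \<and> x \<noteq> y \<and>
        (\<exists>n::int. y = x [^]\<^bsub>G\<^esub> n)} \<rparr>"

text \<open>As usual in the graph library, a simple undirected graph is a symmetric loop-free digraph:
  the edge between \<open>x\<close> and \<open>y\<close> is the pair of arcs \<open>(x, y)\<close> and \<open>(y, x)\<close>.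
  Isomorphisms of such digraphs are exactly isomorphisms of the undirected graphs.\<close>

definition power_graph :: "('a, 'm) monoid_scheme \<Rightarrow> 'a pair_pre_digraph" where
  "power_graph G =
    \<lparr> pverts = carrier G,
      parcs = {(x, y). x \<in> carrier G \<and> y \<in> carrier G \<and> x \<noteq> y \<and>
        (\<exists>n::int. y = x [^]\<^bsub>G\<^esub> n \<or> x = y [^]\<^bsub>G\<^esub> n)} \<rparr>"

lemma wf_directed_power_graph: "wf_digraph (with_proj (directed_power_graph G))"
  by unfold_locales (auto simp: directed_power_graph_def)

lemma wf_power_graph: "wf_digraph (with_proj (power_graph G))"
  by unfold_locales (auto simp: power_graph_def)

lemma symmetric_power_graph: "symmetric (with_proj (power_graph G))"
  by (auto simp: symmetric_def power_graph_def intro!: symI)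

text \<open>For digraphs whose arcs are pairs of vertices, the library's \<open>digraph_iso\<close> (which carries
  a separate map on arcs) amounts to a bijection of the vertices preserving and reflecting arcs.\<close>

lemma digraph_iso_with_proj_iff:
  assumes "wf_digraph (with_proj G)" and "wf_digraph (with_proj H)"
  shows "digraph_iso (with_proj G) (with_proj H) \<longleftrightarrow>
    (\<exists>f. bij_betw f (pverts G) (pverts H) \<and>
      (\<forall>x \<in> pverts G. \<forall>y \<in> pverts G. (x, y) \<in> parcs G \<longleftrightarrow> (f x, f y) \<in> parcs H))"
    (is "?L \<longleftrightarrow> ?R")
proof
  assume ?L
  then obtain h where h: "pre_digraph.digraph_isomorphism (with_proj G) h"
    and H: "with_proj H = app_iso h (with_proj G)"
    unfolding digraph_iso_def by blast
  let ?f = "iso_verts h"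
  have inj: "inj_on ?f (pverts G)"
    and arcs: "\<And>a. a \<in> parcs G \<Longrightarrow>
      ?f (fst a) = iso_tail h (iso_arcs h a) \<and> ?f (snd a) = iso_head h (iso_arcs h a)"
    using h by (auto simp: pre_digraph.digraph_isomorphism_def)
  have H': "pverts H = ?f ` pverts G" "parcs H = iso_arcs h ` parcs G"
      "iso_tail h = fst" "iso_head h = snd"
    using H by (auto simp: with_proj_def app_iso_def)
  have ia: "iso_arcs h a = (?f (fst a), ?f (snd a))" if "a \<in> parcs G" for a
    using arcs[OF that] H'(3,4) by (simp add: prod_eq_iff)
  have wf: "fst a \<in> pverts G" "snd a \<in> pverts G" if "a \<in> parcs G" for a
    using that wf_digraph.tail_in_verts[OF assms(1)] wf_digraph.head_in_verts[OF assms(1)]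
    by auto
  have "(x, y) \<in> parcs G \<longleftrightarrow> (?f x, ?f y) \<in> parcs H" if x: "x \<in> pverts G" and y: "y \<in> pverts G" for x y
  proof
    assume "(x, y) \<in> parcs G"
    then show "(?f x, ?f y) \<in> parcs H"
      using ia[of "(x, y)"] H'(2) by (metis fst_conv imageI snd_conv)
  next
    assume "(?f x, ?f y) \<in> parcs H"
    then obtain a where a: "a \<in> parcs G" "(?f x, ?f y) = iso_arcs h a"
      using H'(2) by auto
    then have "?f x = ?f (fst a)" "?f y = ?f (snd a)" using ia by simp_all
    then have "x = fst a" "y = snd a"
      using inj_onD[OF inj _ x wf(1)[OF a(1)]] inj_onD[OF inj _ y wf(2)[OF a(1)]] by simp_all
    then show "(x, y) \<in> parcs G" using a(1) by simp
  qed
  then show ?R using inj H'(1) by (auto simp: bij_betw_def)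
next
  assume ?R
  then obtain f where f: "inj_on f (pverts G)" "f ` pverts G = pverts H"
    and arcs: "\<And>x y. x \<in> pverts G \<Longrightarrow> y \<in> pverts G \<Longrightarrow> (x, y) \<in> parcs G \<longleftrightarrow> (f x, f y) \<in> parcs H"
    by (auto simp: bij_betw_def)
  define h where "h = \<lparr> iso_verts = f, iso_arcs = map_prod f f, iso_head = snd, iso_tail = fst \<rparr>"
  have wfG: "fst a \<in> pverts G" "snd a \<in> pverts G" if "a \<in> parcs G" for a
    using that wf_digraph.tail_in_verts[OF assms(1)] wf_digraph.head_in_verts[OF assms(1)]
    by auto
  have wfH: "fst a \<in> pverts H" "snd a \<in> pverts H" if "a \<in> parcs H" for a
    using that wf_digraph.tail_in_verts[OF assms(2)] wf_digraph.head_in_verts[OF assms(2)]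
    by auto
  have injA: "inj_on (map_prod f f) (parcs G)"
  proof (rule inj_onI)
    fix a b assume ab: "a \<in> parcs G" "b \<in> parcs G" "map_prod f f a = map_prod f f b"
    then have "f (fst a) = f (fst b)" "f (snd a) = f (snd b)"
      by (simp_all add: map_prod_def split: prod.splits)
    then show "a = b"
      using wfG[OF ab(1)] wfG[OF ab(2)] by (simp add: prod_eq_iff inj_on_eq_iff[OF f(1)])
  qed
  have im: "map_prod f f ` parcs G = parcs H"
  proof (intro equalityI subsetI)
    fix b assume "b \<in> map_prod f f ` parcs G"
    then obtain x y where xy: "(x, y) \<in> parcs G" "b = (f x, f y)" by auto
    then show "b \<in> parcs H"
      using arcs[of x y] wfG[OF xy(1)] by simp
  next
    fix b assume b: "b \<in> parcs H"
    from wfH(1)[OF b] obtain x where x: "x \<in> pverts G" "fst b = f x"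
      unfolding f(2)[symmetric] by blast
    from wfH(2)[OF b] obtain y where y: "y \<in> pverts G" "snd b = f y"
      unfolding f(2)[symmetric] by blast
    have eq: "b = map_prod f f (x, y)" using x(2) y(2) by (simp add: prod_eq_iff)
    then have "(x, y) \<in> parcs G" using b arcs[OF x(1) y(1)] by simp
    then show "b \<in> map_prod f f ` parcs G" unfolding eq by (rule imageI)
  qed
  have "pre_digraph.digraph_isomorphism (with_proj G) h"
    using assms(1) f(1) injA by (auto simp: pre_digraph.digraph_isomorphism_def h_def)
  moreover have "with_proj H = app_iso h (with_proj G)"
    using f(2) im by (simp add: with_proj_def app_iso_def h_def)
  ultimately show ?L unfolding digraph_iso_def by blast
qed

end

theory Submission
  imports Defs "HOL-Algebra.Multiplicative_Group" "HOL-Computational_Algebra.Primes"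
begin

text \<open>Let \<open>f\<close> be an isomorphism of the power graphs; after exchanging two dominating vertices it maps the
  identity to the identity (\<open>identity_preserving_isomorphism\<close>). The power graph is the comparability
  graph of the preorder "\<open>y\<close> is a power of \<open>x\<close>", and the question is how far a comparability graph
  determines its preorder. The basic tool is \<open>forcing\<close>: two arcs at \<open>x\<close> whose other ends are not adjacent are
  either both kept or both reversed by \<open>f\<close>.

  Forcing through powers with coprime exponents shows that all arcs leaving a nonidentity element \<open>x\<close> of
  \<open>G\<close> are treated alike (\<open>outgoing_same_direction\<close>). Since the nonidentity vertices of \<open>G\<close> that share
  their neighbours come in pairs \<open>x\<close>, \<open>x\<^sup>-\<^sup>1\<close>, no torsion can occur in \<open>H\<close>: a cyclic group of finite
  order above 6 has more than two generators (\<open>image_infinite_order\<close>). So each \<open>x\<close> is either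
  preserved or reversed, and not both.

  Next, the orientation is constant on every commensurability class (\<open>commensurable_preserves\<close>).
  Commensurable nonadjacent elements have equal orientation because they have a common power, and \<open>x\<close> is
  linked to \<open>x\<^sup>k\<close> through elements adjacent to neither (\<open>power_preserves\<close>). This needs some element
  of the class that is not adjacent to \<open>x\<close>; otherwise the class and the identity form an infinite cyclic
  group, and the class is preserved because its elements have finitely many roots (\<open>dominating_preserves\<close>).

  A reversed class cannot always be avoided: on the additive group of the rationals, sending each nonzero
  number to its reciprocal is an automorphism of the power graph that reverses all arcs between nonzero
  elements. But every reversed class looks like this one. In a reversed class the roots of an element are ordered as the
  powers of its image are, that is, by reversed divisibility of integers. Hence any two elements have a
  common root, roots are unique, and prime roots exist (\<open>common_root\<close>, \<open>unique_root\<close>,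
  \<open>prime_root\<close>), so that the class is a copy of the nonzero rationals. It therefore has a
  reciprocal map, which reverses all arcs. Precomposing \<open>f\<close> with the reciprocal maps on the reversed classes
  and with the identity elsewhere yields an isomorphism of the directed power graphs.\<close>

section \<open>Powers of elements of infinite order\<close>

definition generates :: "('a, 'm) monoid_scheme \<Rightarrow> 'a \<Rightarrow> 'a \<Rightarrow> bool" where
  "generates G x y \<longleftrightarrow> (\<exists>n::int. y = x [^]\<^bsub>G\<^esub> n)"

definition comparable :: "('a, 'm) monoid_scheme \<Rightarrow> 'a \<Rightarrow> 'a \<Rightarrow> bool" where
  "comparable G x y \<longleftrightarrow> generates G x y \<or> generates G y x"

definition infinite_order :: "('a, 'm) monoid_scheme \<Rightarrow> 'a \<Rightarrow> bool" where
  "infinite_order G x \<longleftrightarrow> (\<forall>n::int. x [^]\<^bsub>G\<^esub> n = \<one>\<^bsub>G\<^esub> \<longrightarrow> n = 0)"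

definition commensurable :: "('a, 'm) monoid_scheme \<Rightarrow> 'a \<Rightarrow> 'a \<Rightarrow> bool" where
  "commensurable G x y \<longleftrightarrow> (\<exists>(a::int) (b::int). a \<noteq> 0 \<and> b \<noteq> 0 \<and> x [^]\<^bsub>G\<^esub> a = y [^]\<^bsub>G\<^esub> b)"

lemma comparable_commute: "comparable G x y \<longleftrightarrow> comparable G y x"
  by (auto simp: comparable_def)

lemma commensurable_sym: "commensurable G x y \<Longrightarrow> commensurable G y x"
  unfolding commensurable_def by metis

lemma coprime_nonunits_incomparable:
  fixes a b :: int
  assumes "coprime a b" "\<not> a dvd 1" "\<not> b dvd 1"
  shows "\<not> a dvd b" "\<not> b dvd a"
  using assms by (metis coprime_absorb_left coprime_absorb_right)+

text \<open>Exponents of the form \<open>2mn + 1\<close> supply powers that are incomparable with given proper powers; the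
  factor 2 keeps them away from 0 and, when \<open>m\<close> and \<open>n\<close> are nonzero and \<open>n\<close> is not a unit, from
  \<open>\<plusminus>1\<close>.\<close>

lemma multiple_plus_one:
  fixes m n :: int
  assumes "m \<noteq> 0" "n \<noteq> 0" "\<not> n dvd 1"
  shows "coprime n (2 * m * n + 1)" "\<not> (2 * m * n + 1) dvd 1" "2 * m * n + 1 \<noteq> 0"
proof -
  have "gcd n (2 * m * n + 1) dvd (2 * m * n + 1) - (2 * m) * n"
    by (intro dvd_diff dvd_mult) auto
  then show "coprime n (2 * m * n + 1)" by (simp add: coprime_iff_gcd_eq_1)
  have "m * n \<noteq> -1"
  proof
    assume "m * n = -1"
    then have "1 = n * (- m)" by (simp add: mult.commute)
    then show False using assms(3) by (metis dvd_triv_left)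
  qed
  moreover have "m * n \<noteq> 0" using assms by simp
  ultimately show "\<not> (2 * m * n + 1) dvd 1"
    unfolding zdvd1_eq mult.assoc by presburger
  show "2 * m * n + 1 \<noteq> 0" unfolding mult.assoc by presburger
qed

context group
begin

lemma generates_refl [simp]: "x \<in> carrier G \<Longrightarrow> generates G x x"
  unfolding generates_def by (metis int_pow_1)

lemma generates_one [simp]: "generates G x \<one>"
  unfolding generates_def by (metis int_pow_0)

lemma one_generates_iff: "generates G \<one> x \<longleftrightarrow> x = \<one>"
  unfolding generates_def by simp

lemma generates_pow [simp]: "generates G x (x [^] (n::int))"
  unfolding generates_def by blast

lemma generates_trans:
  "x \<in> carrier G \<Longrightarrow> generates G x y \<Longrightarrow> generates G y z \<Longrightarrow> generates G x z"
  unfolding generates_def by (metis int_pow_pow)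

lemma equivalent_comparable:
  assumes "x \<in> carrier G" "y \<in> carrier G" "z \<in> carrier G"
    and "generates G x y" "generates G y x" "comparable G x z"
  shows "comparable G y z"
  using assms generates_trans unfolding comparable_def by metis

lemma generates_combination:
  assumes "x \<in> carrier G" "z \<in> carrier G" "generates G x (z [^] (a::int))"
    "generates G x (z [^] (b::int))" "s * a + t * b = 1"
  shows "generates G x z"
proof -
  obtain i j :: int where "z [^] a = x [^] i" "z [^] b = x [^] j"
    using assms unfolding generates_def by blast
  then have "x [^] (i * s + j * t) = (z [^] a) [^] s \<otimes> (z [^] b) [^] t"
    using assms by (simp add: int_pow_mult int_pow_pow)
  also have "\<dots> = z [^] (s * a + t * b)"
    using assms(2) by (simp add: int_pow_mult int_pow_pow mult.commute)
  also have "\<dots> = z" using assms(2,5) by simp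
  finally show ?thesis unfolding generates_def by metis
qed

lemma infinite_order_inj:
  assumes "infinite_order G x" "x \<in> carrier G"
  shows "x [^] (a::int) = x [^] (b::int) \<longleftrightarrow> a = b"
proof
  assume "x [^] a = x [^] b"
  then have "x [^] (a - b) = \<one>" using assms by (simp add: int_pow_diff)
  then show "a = b" using assms unfolding infinite_order_def by fastforce
qed simp

lemma infinite_order_generates:
  assumes "infinite_order G x" "x \<in> carrier G"
  shows "generates G (x [^] (a::int)) (x [^] (b::int)) \<longleftrightarrow> a dvd b"
  unfolding generates_def using assms
  by (simp add: int_pow_pow infinite_order_inj dvd_def)

lemma infinite_order_comparable:
  assumes "infinite_order G x" "x \<in> carrier G"
  shows "comparable G (x [^] (a::int)) (x [^] (b::int)) \<longleftrightarrow> a dvd b \<or> b dvd a"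
  unfolding comparable_def using assms by (simp add: infinite_order_generates)

lemma infinite_order_pow:
  assumes "infinite_order G x" "x \<in> carrier G" "n \<noteq> 0"
  shows "infinite_order G (x [^] (n::int))"
  using assms unfolding infinite_order_def by (metis int_pow_pow mult_eq_0_iff)

text \<open>The witness \<open>x\<^sup>2\<^sup>n\<^sup>+\<^sup>1\<close> is a power of \<open>x\<close>, and it is incomparable with \<open>x\<^sup>n\<close> as soon as
  \<open>n\<close> is neither 0 nor a unit, since \<open>2n + 1\<close> is then a nonunit coprime to \<open>n\<close>.\<close>

lemma incomparable_power:
  assumes "infinite_order G x" "x \<in> carrier G" "n \<noteq> 0" "\<not> n dvd 1"
  shows "\<not> comparable G (x [^] (n::int)) (x [^] (2 * n + 1))"
proof -
  have "coprime n (2 * n + 1)" "\<not> (2 * n + 1) dvd 1"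
    using multiple_plus_one[of 1 n] assms by auto
  then show ?thesis
    using assms coprime_nonunits_incomparable[of n "2 * n + 1"]
    by (simp add: infinite_order_comparable)
qed

lemma unit_power_cases:
  assumes "x \<in> carrier G" "n dvd 1"
  shows "x [^] (n::int) = x \<or> x [^] n = inv x"
proof -
  have "n = 1 \<or> n = -1" using assms by auto
  then show ?thesis using assms by (auto simp: int_pow_neg)
qed

lemma unit_power_generates:
  assumes "x \<in> carrier G" "n dvd 1"
  shows "generates G (x [^] (n::int)) x"
proof -
  have "n * n = 1" using assms by (metis abs_mult_self_eq mult_1 zdvd1_eq)
  then have "(x [^] n) [^] n = x" using assms by (simp add: int_pow_pow)
  then show ?thesis by (metis generates_pow)
qed

lemma generates_inv:
  assumes "x \<in> carrier G"
  shows "generates G x (inv x)" "generates G (inv x) x"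
proof -
  have "x [^] (-1::int) = inv x" using assms int_pow_neg[of x 1] by simp
  then show "generates G x (inv x)" "generates G (inv x) x"
    using unit_power_generates[OF assms, of "-1"] generates_pow[of x "-1"] by auto
qed

lemma commensurable_refl [simp]: "x \<in> carrier G \<Longrightarrow> commensurable G x x"
  unfolding commensurable_def by (metis one_neq_zero)

lemma commensurable_trans:
  assumes "x \<in> carrier G" "y \<in> carrier G" "z \<in> carrier G"
    and "commensurable G x y" "commensurable G y z"
  shows "commensurable G x z"
proof -
  obtain a b c d :: int where abcd: "a \<noteq> 0" "b \<noteq> 0" "c \<noteq> 0" "d \<noteq> 0"
    "x [^] a = y [^] b" "y [^] c = z [^] d"
    using assms unfolding commensurable_def by blast
  have "x [^] (a * c) = y [^] (b * c)" using abcd(5) assms by (metis int_pow_pow)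
  also have "\<dots> = z [^] (d * b)" using abcd(6) assms by (metis int_pow_pow mult.commute)
  finally show ?thesis using abcd unfolding commensurable_def
    by (metis mult_eq_0_iff)
qed

lemma commensurable_pow:
  assumes "x \<in> carrier G" "n \<noteq> 0"
  shows "commensurable G x (x [^] (n::int))"
  unfolding commensurable_def using assms by (metis int_pow_1 int_pow_closed one_neq_zero)

lemma generates_commensurable:
  assumes "x \<in> carrier G" "generates G x y" "y \<noteq> \<one>"
  shows "commensurable G x y"
  using assms unfolding generates_def by (metis commensurable_pow int_pow_0)

lemma comparable_commensurable:
  assumes "x \<in> carrier G" "y \<in> carrier G" "comparable G x y" "x \<noteq> \<one>" "y \<noteq> \<one>"
  shows "commensurable G x y"
  using assms generates_commensurable commensurable_sym unfolding comparable_def by metis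

lemma ord_pos:
  assumes "x \<in> carrier G" "\<not> infinite_order G x"
  shows "ord x > 0"
proof (rule ccontr)
  assume "\<not> ord x > 0"
  then have "infinite_order G x"
    using assms by (simp add: infinite_order_def int_pow_eq_id)
  then show False using assms by blast
qed

end

section \<open>Generators of a finite cyclic group\<close>

text \<open>Euler's totient exceeds 2 beyond 6: besides \<open>\<plusminus>1\<close> there is another unit modulo \<open>m\<close>,
  namely 2, \<open>m/2 + 1\<close> or \<open>m/2 + 2\<close> according to the residue of \<open>m\<close> modulo 4.\<close>

lemma exists_nontrivial_unit_mod:
  fixes m :: int
  assumes "m > 6"
  obtains j where "coprime j m" "1 < j" "j < m - 1"
proof -
  have "m mod 2 = 1 \<or> m mod 4 = 0 \<or> m mod 4 = 2" by presburger
  then consider "m mod 2 = 1" | "m mod 4 = 0" | "m mod 4 = 2" by blast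
  then show thesis
  proof cases
    case 1
    then have "coprime 2 m" by (metis coprime_mod_right_iff coprime_1_right zero_neq_numeral)
    then show thesis using that[of 2] assms by simp
  next
    case 2
    then obtain h where h: "m = 4 * h" by auto
    have "coprime (2 * h + 1) (4 * h)"
    proof (rule coprimeI)
      fix c assume c: "c dvd 2 * h + 1" "c dvd 4 * h"
      have "c dvd (2 * h + 1) * (2 * h + 1) - (h + 1) * (4 * h)"
        by (rule dvd_diff[OF dvd_mult[OF c(1)] dvd_mult[OF c(2)]])
      then show "is_unit c" by (simp add: algebra_simps)
    qed
    then show thesis using that[of "2 * h + 1"] assms h by simp
  next
    case 3
    then obtain h where h: "m = 4 * h + 2" by (metis mult_div_mod_eq)
    have "coprime (2 * h + 3) (4 * h + 2)"
    proof (rule coprimeI)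
      fix c assume c: "c dvd 2 * h + 3" "c dvd 4 * h + 2"
      have "c dvd 2 * (2 * h + 3) - (4 * h + 2)" using c by (intro dvd_diff dvd_mult)
      then have "c dvd 4" by simp
      have "c dvd (2 * h + 3) * (2 * h + 3) - (h * h + 3 * h + 2) * 4"
        using c \<open>c dvd 4\<close> by (intro dvd_diff dvd_mult)
      then show "is_unit c" by (simp add: algebra_simps)
    qed
    then show thesis using that[of "2 * h + 3"] assms h by simp
  qed
qed

lemma (in group) finite_order_powers:
  assumes "x \<in> carrier G" "\<not> infinite_order G x"
  shows "finite (range (\<lambda>n::int. x [^] n))" "card (range (\<lambda>n::int. x [^] n)) \<le> ord x"
proof -
  have pos: "ord x > 0" using ord_pos assms by blast
  have "x [^] n = x [^] (n mod int (ord x))" for n :: int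
    using assms by (simp add: int_pow_eq mod_eq_dvd_iff [symmetric])
  moreover have "n mod int (ord x) \<in> {0..<int (ord x)}" for n :: int
    using pos by simp
  ultimately have sub: "range (\<lambda>n::int. x [^] n) \<subseteq> (\<lambda>n. x [^] n) ` {0..<int (ord x)}"
    by blast
  then show "finite (range (\<lambda>n::int. x [^] n))" by (rule finite_subset) simp
  have "card (range (\<lambda>n::int. x [^] n)) \<le> card ((\<lambda>n. x [^] n) ` {0..<int (ord x)})"
    using sub by (intro card_mono) auto
  also have "\<dots> \<le> card {0..<int (ord x)}" by (intro card_image_le) auto
  finally show "card (range (\<lambda>n::int. x [^] n)) \<le> ord x" by simp
qed

text \<open>In the power graph, the vertices \<open>y\<close>, \<open>y\<^sup>-\<^sup>1\<close> and \<open>z\<close> have the same closed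
  neighbourhood. In a torsion-free group at most two nonidentity vertices can share theirs.\<close>

lemma (in group) exists_third_generator:
  assumes "y \<in> carrier G" "\<not> infinite_order G y" "ord y > 6"
  obtains z where "z \<in> carrier G" "z \<noteq> \<one>" "generates G y z" "generates G z y"
    "z \<noteq> y" "z \<noteq> inv y" "y \<noteq> inv y"
proof -
  define m where "m = int (ord y)"
  have eq: "y [^] (a::int) = y [^] (b::int) \<longleftrightarrow> m dvd b - a" for a b
    using assms(1) by (simp add: int_pow_eq m_def)
  have "m > 6" using assms(3) m_def by simp
  then obtain j where j: "coprime j m" "1 < j" "j < m - 1"
    by (rule exists_nontrivial_unit_mod)
  obtain s t where "s * j + t * m = 1"
    using j(1) bezout_int[of j m] by (auto simp: coprime_iff_gcd_eq_1)
  then have "1 - j * s = t * m" by (simp add: algebra_simps)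
  then have "y [^] (j * s) = y [^] (1::int)" unfolding eq by simp
  then have "(y [^] j) [^] s = y" using assms(1) by (simp add: int_pow_pow)
  then have "generates G (y [^] j) y" by (metis generates_pow)
  moreover have "y [^] j \<noteq> y [^] (0::int)" "y [^] j \<noteq> y [^] (1::int)"
    "y [^] j \<noteq> y [^] (- 1::int)" "y [^] (1::int) \<noteq> y [^] (- 1::int)"
    unfolding eq using j \<open>m > 6\<close> zdvd_imp_le[of m "j + 1"] zdvd_imp_le[of m j]
      zdvd_imp_le[of m "j - 1"] zdvd_imp_le[of m 2]
    by (auto simp: dvd_diff_commute[of m 1 j] dvd_diff_commute[of m 0 j]
        dvd_diff_commute[of m "-1" j] dvd_diff_commute[of m "-1" 1])
  ultimately show thesis
    using that[of "y [^] j"] assms(1) by (simp add: int_pow_neg)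
qed

section \<open>Isomorphisms of power graphs preserve or reverse directions\<close>

text \<open>The power graph always has an automorphism that carries any given dominating vertex to the
  identity, so it costs nothing to consider isomorphisms that preserve the identity.\<close>

locale power_graph_isomorphism = G: group G + H: group H
  for G :: "('a, 'm) monoid_scheme" and H :: "('b, 'n) monoid_scheme" +
  fixes f :: "'a \<Rightarrow> 'b"
  assumes infinite_order: "\<And>x. x \<in> carrier G \<Longrightarrow> x \<noteq> \<one>\<^bsub>G\<^esub> \<Longrightarrow> infinite_order G x"
    and bij: "bij_betw f (carrier G) (carrier H)"
    and f_one: "f \<one>\<^bsub>G\<^esub> = \<one>\<^bsub>H\<^esub>"
    and comparable_iff: "\<And>x y. x \<in> carrier G \<Longrightarrow> y \<in> carrier G \<Longrightarrow>
      comparable H (f x) (f y) \<longleftrightarrow> comparable G x y"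
begin

lemma f_closed [simp]: "x \<in> carrier G \<Longrightarrow> f x \<in> carrier H"
  using bij by (auto simp: bij_betw_def)

lemma f_eq_iff: "x \<in> carrier G \<Longrightarrow> y \<in> carrier G \<Longrightarrow> f x = f y \<longleftrightarrow> x = y"
  using bij by (auto simp: bij_betw_def inj_on_def)

lemma f_eq_one_iff: "x \<in> carrier G \<Longrightarrow> f x = \<one>\<^bsub>H\<^esub> \<longleftrightarrow> x = \<one>\<^bsub>G\<^esub>"
  using f_eq_iff[of x "\<one>\<^bsub>G\<^esub>"] f_one by simp

lemma f_surj:
  assumes "y \<in> carrier H"
  obtains x where "x \<in> carrier G" "f x = y"
  using assms that unfolding bij_betw_imp_surj_on[OF bij, symmetric] by (metis imageE)

lemma pow_eq_one_iff:
  assumes "x \<in> carrier G" "x \<noteq> \<one>\<^bsub>G\<^esub>"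
  shows "x [^]\<^bsub>G\<^esub> (n::int) = \<one>\<^bsub>G\<^esub> \<longleftrightarrow> n = 0"
  using infinite_order[OF assms] unfolding infinite_order_def by auto

lemma nontrivial_power:
  assumes "generates G x z" "z \<noteq> \<one>\<^bsub>G\<^esub>"
  obtains n :: int where "n \<noteq> 0" "z = x [^]\<^bsub>G\<^esub> n"
  using assms unfolding generates_def by (metis int_pow_0)

lemma comparable_pow: "x \<in> carrier G \<Longrightarrow> comparable G x (x [^]\<^bsub>G\<^esub> (n::int))"
  by (simp add: comparable_def)

text \<open>Elements whose images generate each other have the same neighbours in the power graph, and
  a proper power \<open>x\<^sup>n\<close> of \<open>x\<close> misses the neighbour \<open>x\<^sup>2\<^sup>n\<^sup>+\<^sup>1\<close> of \<open>x\<close>.\<close>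

lemma equivalent_images:
  assumes "u \<in> carrier G" "w \<in> carrier G" "u \<noteq> \<one>\<^bsub>G\<^esub>" "w \<noteq> \<one>\<^bsub>G\<^esub>"
    and "generates H (f u) (f w)" "generates H (f w) (f u)"
  shows "w = u \<or> w = inv\<^bsub>G\<^esub> u"
proof -
  have *: "w' = u' \<or> w' = inv\<^bsub>G\<^esub> u'" if u': "u' \<in> carrier G" "w' \<in> carrier G" "u' \<noteq> \<one>\<^bsub>G\<^esub>"
    "w' \<noteq> \<one>\<^bsub>G\<^esub>" "generates H (f u') (f w')" "generates H (f w') (f u')" "generates G u' w'" for u' w'
  proof -
    obtain n :: int where n: "n \<noteq> 0" "w' = u' [^]\<^bsub>G\<^esub> n" using nontrivial_power u' by metis
    have "comparable H (f u') (f (u' [^]\<^bsub>G\<^esub> (2 * n + 1)))"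
      using u' by (simp add: comparable_iff comparable_pow)
    then have "comparable H (f w') (f (u' [^]\<^bsub>G\<^esub> (2 * n + 1)))"
      using u' H.equivalent_comparable[of "f u'" "f w'"] by simp
    then have "n dvd 1"
      using u' n G.incomparable_power infinite_order by (auto simp: comparable_iff)
    then show ?thesis using G.unit_power_cases u' n by blast
  qed
  have "comparable G u w" using assms comparable_iff unfolding comparable_def by blast
  then consider "generates G u w" | "generates G w u" unfolding comparable_def by blast
  then show ?thesis
  proof cases
    case 1
    then show ?thesis using * assms by blast
  next
    case 2
    then have "u = w \<or> u = inv\<^bsub>G\<^esub> w" using * assms by blast
    then show ?thesis using assms by auto
  qed
qed

text \<open>Two arcs at \<open>x\<close> whose other ends are incomparable are mapped with the same orientation: if one were
  kept and the other reversed, transitivity of \<open>generates\<close> through \<open>f x\<close> would make the images of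
  these ends comparable.\<close>

lemma forcing:
  assumes "x \<in> carrier G" "y \<in> carrier G" "z \<in> carrier G"
    and "comparable G x z" "\<not> comparable G y z"
  shows "generates H (f x) (f y) \<Longrightarrow> generates H (f x) (f z)"
    and "generates H (f y) (f x) \<Longrightarrow> generates H (f z) (f x)"
proof -
  have "comparable H (f x) (f z)" "\<not> comparable H (f y) (f z)"
    using assms comparable_iff by auto
  then show "generates H (f x) (f y) \<Longrightarrow> generates H (f x) (f z)"
    and "generates H (f y) (f x) \<Longrightarrow> generates H (f z) (f x)"
    using assms H.generates_trans f_closed unfolding comparable_def by metis+
qed

text \<open>A third exponent coprime to both \<open>n\<close> and \<open>m\<close> gives a power of \<open>x\<close> incomparable with
  \<open>x\<^sup>n\<close> and with \<open>x\<^sup>m\<close>; forcing passes through it.\<close>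

lemma outgoing_same_direction:
  assumes "x \<in> carrier G" "x \<noteq> \<one>\<^bsub>G\<^esub>"
    and "n \<noteq> 0" "\<not> n dvd (1::int)" "m \<noteq> 0" "\<not> m dvd (1::int)"
  shows "generates H (f x) (f (x [^]\<^bsub>G\<^esub> n)) \<Longrightarrow> generates H (f x) (f (x [^]\<^bsub>G\<^esub> m))"
    and "generates H (f (x [^]\<^bsub>G\<^esub> n)) (f x) \<Longrightarrow> generates H (f (x [^]\<^bsub>G\<^esub> m)) (f x)"
proof -
  define q where "q = 2 * m * n + 1"
  have q: "coprime n q" "\<not> q dvd 1" "coprime m q"
    using multiple_plus_one[of m n] multiple_plus_one[of n m] assms
    unfolding q_def by (auto simp: ac_simps)
  have inc: "\<not> comparable G (x [^]\<^bsub>G\<^esub> n) (x [^]\<^bsub>G\<^esub> q)" "\<not> comparable G (x [^]\<^bsub>G\<^esub> q) (x [^]\<^bsub>G\<^esub> m)"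
    using coprime_nonunits_incomparable[of n q] coprime_nonunits_incomparable[of m q] q assms
    by (auto simp: G.infinite_order_comparable infinite_order)
  note step = forcing[OF assms(1) _ _ comparable_pow[OF assms(1)]]
  show "generates H (f x) (f (x [^]\<^bsub>G\<^esub> n)) \<Longrightarrow> generates H (f x) (f (x [^]\<^bsub>G\<^esub> m))"
    using step(1)[OF _ _ inc(1)] step(1)[OF _ _ inc(2)] assms(1) by simp
  show "generates H (f (x [^]\<^bsub>G\<^esub> n)) (f x) \<Longrightarrow> generates H (f (x [^]\<^bsub>G\<^esub> m)) (f x)"
    using step(2)[OF _ _ inc(1)] step(2)[OF _ _ inc(2)] assms(1) by simp
qed

lemma outgoing_dichotomy:
  assumes "x \<in> carrier G" "x \<noteq> \<one>\<^bsub>G\<^esub>"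
  shows "(\<forall>n::int. n \<noteq> 0 \<longrightarrow> \<not> n dvd 1 \<longrightarrow> generates H (f x) (f (x [^]\<^bsub>G\<^esub> n))) \<or>
    (\<forall>n::int. n \<noteq> 0 \<longrightarrow> \<not> n dvd 1 \<longrightarrow> generates H (f (x [^]\<^bsub>G\<^esub> n)) (f x))"
proof -
  have "comparable H (f x) (f (x [^]\<^bsub>G\<^esub> (2::int)))"
    using assms by (simp add: comparable_iff comparable_pow)
  then show ?thesis
    unfolding comparable_def using outgoing_same_direction[OF assms, of 2] by auto
qed

text \<open>Suppose that \<open>f x\<close> has finite order. It has finitely many powers, so the arcs out of \<open>x\<close> must be
  reversed, and likewise the arcs out of all powers of \<open>x\<close>. Then \<open>f (x\<^sup>6\<^sup>4)\<close> has among its powers the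
  images of the seven elements \<open>x\<close>, \<open>x\<^sup>2\<close>, ..., \<open>x\<^sup>6\<^sup>4\<close>, so its order is finite but exceeds 6. Hence
  at least three elements generate the same cyclic group, while a nonidentity element of
  \<open>G\<close> shares its neighbours with no other one except its inverse.\<close>

lemma image_infinite_order:
  assumes x: "x \<in> carrier G" "x \<noteq> \<one>\<^bsub>G\<^esub>"
  shows "infinite_order H (f x)"
proof (rule ccontr)
  assume fin: "\<not> infinite_order H (f x)"
  note xinf = infinite_order[OF x]
  have reversed: "generates H (f (u [^]\<^bsub>G\<^esub> n)) (f u)"
    if u: "u \<in> carrier G" "u \<noteq> \<one>\<^bsub>G\<^esub>" "\<not> infinite_order H (f u)" and n: "n \<noteq> 0" "\<not> n dvd (1::int)"
    for u n
  proof (rule ccontr)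
    assume "\<not> generates H (f (u [^]\<^bsub>G\<^esub> n)) (f u)"
    then have *: "\<forall>n::int. n \<noteq> 0 \<longrightarrow> \<not> n dvd 1 \<longrightarrow> generates H (f u) (f (u [^]\<^bsub>G\<^esub> n))"
      using outgoing_dichotomy[OF u(1,2)] n by blast
    \<comment> \<open>The shift by 2 leaves out the exponents 0 and 1, about which the dichotomy is silent.\<close>
    have "range (\<lambda>k::nat. f (u [^]\<^bsub>G\<^esub> (int k + 2))) \<subseteq> range (\<lambda>i::int. f u [^]\<^bsub>H\<^esub> i)"
    proof (rule image_subsetI)
      fix k :: nat
      have "generates H (f u) (f (u [^]\<^bsub>G\<^esub> (int k + 2)))"
        using * by (simp add: zdvd1_eq)
      then show "f (u [^]\<^bsub>G\<^esub> (int k + 2)) \<in> range (\<lambda>i::int. f u [^]\<^bsub>H\<^esub> i)"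
        unfolding generates_def by auto
    qed
    then have "finite (range (\<lambda>k::nat. f (u [^]\<^bsub>G\<^esub> (int k + 2))))"
      using H.finite_order_powers(1) u by (meson f_closed finite_subset)
    moreover have "inj (\<lambda>k::nat. f (u [^]\<^bsub>G\<^esub> (int k + 2)))"
      using u by (auto simp: inj_on_def f_eq_iff G.infinite_order_inj infinite_order)
    ultimately show False using finite_imageD infinite_UNIV_nat by blast
  qed
  have fin_pow: "\<not> infinite_order H (f (x [^]\<^bsub>G\<^esub> n))" if n: "n \<noteq> 0" "\<not> n dvd (1::int)" for n
  proof
    assume inf: "infinite_order H (f (x [^]\<^bsub>G\<^esub> n))"
    obtain i :: int where i: "f x = f (x [^]\<^bsub>G\<^esub> n) [^]\<^bsub>H\<^esub> i"
      using reversed[OF x fin n] generates_def by metis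
    then have "i \<noteq> 0" using x f_eq_one_iff by fastforce
    then show False using H.infinite_order_pow[OF inf] i fin x by simp
  qed
  define v y where "v = x [^]\<^bsub>G\<^esub> (64::int)" and "y = f v"
  have v: "v \<in> carrier G" "v \<noteq> \<one>\<^bsub>G\<^esub>" "y \<in> carrier H" "\<not> infinite_order H y"
    using x fin_pow[of 64] by (auto simp: v_def y_def pow_eq_one_iff)
  have "f (x [^]\<^bsub>G\<^esub> (2 ^ i :: int)) \<in> range (\<lambda>n::int. y [^]\<^bsub>H\<^esub> n)" if "i \<le> 6" for i :: nat
  proof (cases "i = 6")
    case True
    then have "f (x [^]\<^bsub>G\<^esub> (2 ^ i :: int)) = y [^]\<^bsub>H\<^esub> (1::int)"
      using v by (simp add: y_def v_def)
    then show ?thesis by blast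
  next
    case False
    have "\<not> infinite_order H (f (x [^]\<^bsub>G\<^esub> (2 ^ i :: int)))"
      using fin fin_pow[of "2 ^ i"] x by (cases "i = 0") (auto simp: zdvd1_eq)
    moreover have "\<not> (2 ^ (6 - i) :: int) dvd 1"
      using False that by (auto simp: zdvd1_eq)
    ultimately have "generates H (f ((x [^]\<^bsub>G\<^esub> (2 ^ i :: int)) [^]\<^bsub>G\<^esub> (2 ^ (6 - i) :: int)))
        (f (x [^]\<^bsub>G\<^esub> (2 ^ i :: int)))"
      using x by (intro reversed) (auto simp: pow_eq_one_iff)
    moreover have "(2::int) ^ i * 2 ^ (6 - i) = 64"
      using that by (simp flip: power_add)
    ultimately show ?thesis
      using x by (auto simp: G.int_pow_pow generates_def y_def v_def)
  qed
  then have "(\<lambda>i::nat. f (x [^]\<^bsub>G\<^esub> (2 ^ i :: int))) ` {..6} \<subseteq> range (\<lambda>n::int. y [^]\<^bsub>H\<^esub> n)"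
    by auto
  moreover have "inj_on (\<lambda>i::nat. f (x [^]\<^bsub>G\<^esub> (2 ^ i :: int))) {..6}"
    using x by (auto simp: inj_on_def f_eq_iff G.infinite_order_inj xinf)
  ultimately have "card {..6::nat} \<le> card (range (\<lambda>n::int. y [^]\<^bsub>H\<^esub> n))"
    using H.finite_order_powers(1)[OF v(3,4)] by (meson card_inj_on_le)
  then have "H.ord y > 6"
    using H.finite_order_powers(2)[OF v(3,4)] by simp
  then obtain z where z: "z \<in> carrier H" "z \<noteq> \<one>\<^bsub>H\<^esub>" "generates H y z" "generates H z y"
    "z \<noteq> y" "z \<noteq> inv\<^bsub>H\<^esub> y" "y \<noteq> inv\<^bsub>H\<^esub> y"
    using H.exists_third_generator v by metis
  obtain u where u: "u \<in> carrier G" "f u = z" using f_surj z by blast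
  have "u = v \<or> u = inv\<^bsub>G\<^esub> v"
    using equivalent_images[of v u] u v z y_def f_one by auto
  then have u_eq: "u = inv\<^bsub>G\<^esub> v" using u z y_def by auto
  obtain w where w: "w \<in> carrier G" "f w = inv\<^bsub>H\<^esub> y"
    by (rule f_surj[OF H.inv_closed[OF v(3)]])
  have "y \<noteq> \<one>\<^bsub>H\<^esub>" using v(2) f_eq_one_iff[OF v(1)] by (simp add: y_def)
  then have "w \<noteq> \<one>\<^bsub>G\<^esub>" using w(2) v(3) f_one H.inv_inv H.inv_one by metis
  moreover have "generates H y (inv\<^bsub>H\<^esub> y)" "generates H (inv\<^bsub>H\<^esub> y) y"
    using H.generates_inv[OF v(3)] by blast+
  ultimately have "w = v \<or> w = inv\<^bsub>G\<^esub> v"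
    using equivalent_images[OF v(1) w(1) v(2)] w(2) by (simp add: y_def)
  then have "f w = y \<or> f w = z" using u(2) u_eq by (auto simp: y_def)
  then show False using w(2) z(6,7) by auto
qed

section \<open>The orientation is constant on commensurability classes\<close>

definition preserves :: "'a \<Rightarrow> bool" where
  "preserves x \<longleftrightarrow> (\<forall>n::int. n \<noteq> 0 \<longrightarrow> generates H (f x) (f (x [^]\<^bsub>G\<^esub> n)))"

definition reverses :: "'a \<Rightarrow> bool" where
  "reverses x \<longleftrightarrow> (\<forall>n::int. n \<noteq> 0 \<longrightarrow> generates H (f (x [^]\<^bsub>G\<^esub> n)) (f x))"

text \<open>\<open>x\<close> and \<open>z\<close> have the same neighbours, so their images
  do, and as the images have infinite order the incomparable power argument applies in \<open>H\<close> as well.\<close>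

lemma equivalent_preserved:
  assumes x: "x \<in> carrier G" "x \<noteq> \<one>\<^bsub>G\<^esub>" and z: "z \<in> carrier G" "z \<noteq> \<one>\<^bsub>G\<^esub>"
    and xz: "generates G x z" "generates G z x"
  shows "generates H (f x) (f z)"
proof (rule ccontr)
  assume not: "\<not> generates H (f x) (f z)"
  have "comparable G x z" using xz comparable_def by metis
  then have "generates H (f z) (f x)"
    using comparable_iff[of x z] x z not unfolding comparable_def by blast
  then obtain n :: int where n: "f x = f z [^]\<^bsub>H\<^esub> n" using generates_def by metis
  then have "n \<noteq> 0" using x f_eq_one_iff by fastforce
  moreover have "\<not> n dvd 1"
    using H.unit_power_generates[of "f z" n] z n not by auto
  ultimately have inc: "\<not> comparable H (f x) (f z [^]\<^bsub>H\<^esub> (2 * n + 1))"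
    using H.incomparable_power[of "f z" n] image_infinite_order z n by simp
  obtain w where w: "w \<in> carrier G" "f w = f z [^]\<^bsub>H\<^esub> (2 * n + 1)"
    using f_surj[of "f z [^]\<^bsub>H\<^esub> (2 * n + 1)"] z by auto
  have "comparable H (f z) (f w)" unfolding w comparable_def by simp
  then have "comparable G z w" using comparable_iff w z by blast
  then have "comparable G x w" using G.equivalent_comparable x z w xz by metis
  then show False using inc comparable_iff x w by metis
qed

lemma preserves_or_reverses:
  assumes "x \<in> carrier G" "x \<noteq> \<one>\<^bsub>G\<^esub>"
  shows "preserves x \<or> reverses x"
proof -
  have "generates H (f x) (f (x [^]\<^bsub>G\<^esub> n)) \<and> generates H (f (x [^]\<^bsub>G\<^esub> n)) (f x)"
    if "n dvd 1" for n :: int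
  proof -
    have "n \<noteq> 0" using that by auto
    then have "x [^]\<^bsub>G\<^esub> n \<in> carrier G" "x [^]\<^bsub>G\<^esub> n \<noteq> \<one>\<^bsub>G\<^esub>"
      using assms pow_eq_one_iff by auto
    then show ?thesis
      using equivalent_preserved assms G.unit_power_generates[OF assms(1) that] G.generates_pow
      by metis
  qed
  then show ?thesis
    unfolding preserves_def reverses_def using outgoing_dichotomy[OF assms] by metis
qed

lemma not_preserves_and_reverses:
  assumes "x \<in> carrier G" "x \<noteq> \<one>\<^bsub>G\<^esub>" "preserves x" "reverses x"
  shows False
proof -
  let ?z = "x [^]\<^bsub>G\<^esub> (2::int)"
  have "generates H (f x) (f ?z)" "generates H (f ?z) (f x)"
    using assms unfolding preserves_def reverses_def by auto
  then have "?z = x \<or> ?z = inv\<^bsub>G\<^esub> x"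
    using equivalent_images assms pow_eq_one_iff by simp
  then have "?z = x [^]\<^bsub>G\<^esub> (1::int) \<or> ?z = x [^]\<^bsub>G\<^esub> (-1::int)"
    using assms by (simp add: G.int_pow_neg)
  then show False
    unfolding G.infinite_order_inj[OF infinite_order[OF assms(1,2)] assms(1)] by simp
qed

lemma reverses_iff_not_preserves:
  "x \<in> carrier G \<Longrightarrow> x \<noteq> \<one>\<^bsub>G\<^esub> \<Longrightarrow> reverses x \<longleftrightarrow> \<not> preserves x"
  using preserves_or_reverses not_preserves_and_reverses by blast

lemma preservesD: "preserves x \<Longrightarrow> generates G x z \<Longrightarrow> z \<noteq> \<one>\<^bsub>G\<^esub> \<Longrightarrow> generates H (f x) (f z)"
  unfolding preserves_def using nontrivial_power by metis

lemma reversesD: "reverses x \<Longrightarrow> generates G x z \<Longrightarrow> z \<noteq> \<one>\<^bsub>G\<^esub> \<Longrightarrow> generates H (f z) (f x)"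
  unfolding reverses_def using nontrivial_power by metis

lemma preserves_iff:
  assumes x: "x \<in> carrier G" "x \<noteq> \<one>\<^bsub>G\<^esub>" "preserves x"
    and z: "z \<in> carrier G" "z \<noteq> \<one>\<^bsub>G\<^esub>" "preserves z"
  shows "generates H (f x) (f z) \<longleftrightarrow> generates G x z"
proof
  assume xz: "generates H (f x) (f z)"
  then have "comparable G x z" using comparable_iff x z comparable_def by metis
  moreover have "generates G x z" if zx: "generates G z x"
  proof -
    have "z = x \<or> z = inv\<^bsub>G\<^esub> x"
      using equivalent_images x z xz preservesD[OF z(3) zx] by blast
    then show ?thesis using x G.generates_inv[of x] by auto
  qed
  ultimately show "generates G x z" unfolding comparable_def by blast
qed (use preservesD x z in blast)

lemma reverses_iff:
  assumes x: "x \<in> carrier G" "x \<noteq> \<one>\<^bsub>G\<^esub>" "reverses x"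
    and z: "z \<in> carrier G" "z \<noteq> \<one>\<^bsub>G\<^esub>" "reverses z"
  shows "generates H (f x) (f z) \<longleftrightarrow> generates G z x"
proof
  assume xz: "generates H (f x) (f z)"
  then have "comparable G x z" using comparable_iff x z comparable_def by metis
  moreover have "generates G z x" if zx: "generates G x z"
  proof -
    have "x = z \<or> x = inv\<^bsub>G\<^esub> z"
      using equivalent_images x z xz reversesD[OF x(3) zx] by blast
    then show ?thesis using z G.generates_inv[of z] by auto
  qed
  ultimately show "generates G z x" unfolding comparable_def by blast
qed (use reversesD x z in blast)

text \<open>At a common power of \<open>x\<close> and \<open>v\<close> the arcs from the two elements must be oriented alike, again by
  transitivity.\<close>

lemma incomparable_preserves:
  assumes x: "x \<in> carrier G" "x \<noteq> \<one>\<^bsub>G\<^esub>" and v: "v \<in> carrier G" "v \<noteq> \<one>\<^bsub>G\<^esub>"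
    and "commensurable G x v" "\<not> comparable G x v"
  shows "preserves x \<longleftrightarrow> preserves v"
proof -
  have *: "preserves v'" if h: "x' \<in> carrier G" "x' \<noteq> \<one>\<^bsub>G\<^esub>" "v' \<in> carrier G" "v' \<noteq> \<one>\<^bsub>G\<^esub>"
    "commensurable G x' v'" "\<not> comparable G x' v'" "preserves x'" for x' v'
  proof (rule ccontr)
    assume "\<not> preserves v'"
    then have rev: "reverses v'" using h preserves_or_reverses by blast
    obtain a b :: int where ab: "a \<noteq> 0" "b \<noteq> 0" "x' [^]\<^bsub>G\<^esub> a = v' [^]\<^bsub>G\<^esub> b"
      using h unfolding commensurable_def by blast
    have "generates H (f x') (f (x' [^]\<^bsub>G\<^esub> a))" "generates H (f (x' [^]\<^bsub>G\<^esub> a)) (f v')"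
      using ab h rev unfolding preserves_def reverses_def by auto
    then have "generates H (f x') (f v')" using H.generates_trans h f_closed by metis
    then show False using h comparable_iff comparable_def by metis
  qed
  show ?thesis
    using *[OF x v] *[OF v x] assms(5,6) commensurable_sym comparable_commute by metis
qed

text \<open>If \<open>v\<close> is incomparable with \<open>x\<close> but has \<open>x\<^sup>k\<close> as a power \<open>v\<^sup>m\<close>, then one of
  \<open>v\<^sup>2\<^sup>m\<^sup>+\<^sup>1\<close> and \<open>v\<^sup>2\<^sup>m\<^sup>-\<^sup>1\<close> is incomparable with both \<open>x\<close> and \<open>x\<^sup>k\<close>: the exponents are coprime,
  so if both elements were powers of \<open>x\<close>, then so would be \<open>v\<close>.\<close>

lemma power_preserves:
  assumes x: "x \<in> carrier G" "x \<noteq> \<one>\<^bsub>G\<^esub>" and v: "v \<in> carrier G" "v \<noteq> \<one>\<^bsub>G\<^esub>"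
    and xv: "commensurable G x v" "\<not> comparable G x v" and k: "k \<noteq> (0::int)"
  shows "preserves (x [^]\<^bsub>G\<^esub> k) \<longleftrightarrow> preserves x"
proof -
  let ?z = "x [^]\<^bsub>G\<^esub> k"
  have z: "?z \<in> carrier G" "?z \<noteq> \<one>\<^bsub>G\<^esub>" using x k pow_eq_one_iff by auto
  have xz: "commensurable G x ?z" using G.commensurable_pow x k by blast
  have via: ?thesis if w: "w \<in> carrier G" "w \<noteq> \<one>\<^bsub>G\<^esub>" "commensurable G x w"
    "\<not> comparable G x w" "\<not> comparable G ?z w" for w
  proof -
    have "commensurable G ?z w"
      by (rule G.commensurable_trans[OF z(1) x(1) w(1) commensurable_sym[OF xz] w(3)])
    then show ?thesis
      using incomparable_preserves[OF x w(1-4)] incomparable_preserves[OF z w(1,2) _ w(5)] by simp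
  qed
  show ?thesis
  proof (cases "comparable G ?z v")
    case False
    then show ?thesis by (rule via[OF v xv])
  next
    case True
    have "\<not> generates G ?z v"
      using xv x G.generates_trans[of x ?z v] unfolding comparable_def by auto
    then have "generates G v ?z" using True comparable_def by metis
    then obtain m :: int where m: "m \<noteq> 0" "?z = v [^]\<^bsub>G\<^esub> m"
      using nontrivial_power z by metis
    have "\<not> m dvd 1"
      using G.unit_power_generates[of v m] \<open>\<not> generates G ?z v\<close> v m by auto
    define w where "w q = v [^]\<^bsub>G\<^esub> q" for q :: int
    have q: "coprime m q" "\<not> q dvd 1" "q \<noteq> 0" if "q = 2 * m + 1 \<or> q = - (2 * m - 1)" for q
      using multiple_plus_one[of 1 m] multiple_plus_one[of "-1" m] m(1) \<open>\<not> m dvd 1\<close> that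
      by auto
    have inc: "\<not> comparable G ?z (w q)" if "q = 2 * m + 1 \<or> q = - (2 * m - 1)" for q
      unfolding m(2) w_def
      using coprime_nonunits_incomparable[of m q] q[OF that] \<open>\<not> m dvd 1\<close> v
      by (auto simp: G.infinite_order_comparable infinite_order)
    have "\<not> (generates G x (w (2 * m + 1)) \<and> generates G x (w (- (2 * m - 1))))"
    proof
      assume "generates G x (w (2 * m + 1)) \<and> generates G x (w (- (2 * m - 1)))"
      then have "generates G x v"
        unfolding w_def
        using G.generates_combination[of x v "2 * m + 1" "- (2 * m - 1)" "1 - m" "- m"] x v
        by (simp add: algebra_simps)
      then show False using xv comparable_def by metis
    qed
    then obtain q where q': "q = 2 * m + 1 \<or> q = - (2 * m - 1)" "\<not> generates G x (w q)"
      by blast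
    have "\<not> generates G (w q) x"
      using xv v G.generates_trans[of v "w q" x] unfolding w_def comparable_def by auto
    then have "\<not> comparable G x (w q)" using q' comparable_def by metis
    moreover have "w q \<in> carrier G" "w q \<noteq> \<one>\<^bsub>G\<^esub>"
      using v q[OF q'(1)] pow_eq_one_iff by (auto simp: w_def)
    moreover have "commensurable G x (w q)"
      using G.commensurable_trans[OF x(1) v(1) _ xv(1)] G.commensurable_pow[OF v(1) q(3)[OF q'(1)]]
        v by (simp add: w_def)
    ultimately show ?thesis using via inc[OF q'(1)] by metis
  qed
qed

text \<open>A power of \<open>f z\<close> is the image of a neighbour \<open>v\<close> of \<open>z\<close>. Were \<open>v\<close> a power of \<open>z\<close>, then by reversal
  \<open>f z\<close> would also be a power of \<open>f v\<close>, and \<open>v\<close> would be \<open>z\<close> or its inverse.\<close>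

lemma reverses_image_power:
  assumes z: "z \<in> carrier G" "z \<noteq> \<one>\<^bsub>G\<^esub>" "reverses z" and n: "n \<noteq> (0::int)"
  obtains v where "v \<in> carrier G" "v \<noteq> \<one>\<^bsub>G\<^esub>" "f v = f z [^]\<^bsub>H\<^esub> n" "generates G v z"
proof -
  obtain v where v: "v \<in> carrier G" "f v = f z [^]\<^bsub>H\<^esub> n"
    using f_surj[of "f z [^]\<^bsub>H\<^esub> n"] z by auto
  have v1: "v \<noteq> \<one>\<^bsub>G\<^esub>"
    using v image_infinite_order[OF z(1,2)] n f_one unfolding infinite_order_def by metis
  have zv: "generates H (f z) (f v)" unfolding v(2) by simp
  then have "comparable G z v" using comparable_iff z v comparable_def by metis
  moreover have "generates G v z" if "generates G z v"
  proof -
    have "z = v \<or> z = inv\<^bsub>G\<^esub> v"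
      using equivalent_images v v1 z zv reversesD[OF z(3) that v1] by blast
    then show ?thesis using v G.generates_inv[of v] by auto
  qed
  ultimately show thesis using that v v1 unfolding comparable_def by blast
qed

text \<open>An element adjacent to its whole class has no proper roots, so the class consists of its powers and
  every element of the class has finitely many roots. A reversal at \<open>z\<close> would turn the infinitely many
  powers of \<open>f z\<close> into images of roots of \<open>z\<close>.\<close>

lemma dominating_preserves:
  assumes x: "x \<in> carrier G" "x \<noteq> \<one>\<^bsub>G\<^esub>"
    and dom: "\<And>v. v \<in> carrier G \<Longrightarrow> v \<noteq> \<one>\<^bsub>G\<^esub> \<Longrightarrow> commensurable G x v \<Longrightarrow> comparable G x v"
    and z: "z \<in> carrier G" "z \<noteq> \<one>\<^bsub>G\<^esub>" "commensurable G x z"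
  shows "preserves z"
proof (rule ccontr)
  assume "\<not> preserves z"
  then have rev: "reverses z" using preserves_or_reverses z by blast
  have gen: "generates G x v" if v: "v \<in> carrier G" "v \<noteq> \<one>\<^bsub>G\<^esub>" "commensurable G x v" for v
  proof (rule ccontr)
    assume not: "\<not> generates G x v"
    then have "generates G v x" using dom[OF v] comparable_def by metis
    then obtain k :: int where k: "k \<noteq> 0" "x = v [^]\<^bsub>G\<^esub> k" using nontrivial_power x by metis
    have "\<not> k dvd 1" using G.unit_power_generates[of v k] v k not by auto
    then have "\<not> comparable G x (v [^]\<^bsub>G\<^esub> (2 * k + 1))"
      using G.incomparable_power[of v k] infinite_order v k by blast
    moreover have "2 * k + 1 \<noteq> 0" by presburger
    then have "v [^]\<^bsub>G\<^esub> (2 * k + 1) \<noteq> \<one>\<^bsub>G\<^esub>" "commensurable G v (v [^]\<^bsub>G\<^esub> (2 * k + 1))"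
      using pow_eq_one_iff[OF v(1,2)] G.commensurable_pow[OF v(1)] by blast+
    ultimately show False
      using dom G.commensurable_trans[OF x(1) v(1) _ v(3)] v(1) by blast
  qed
  obtain k :: int where k: "k \<noteq> 0" "z = x [^]\<^bsub>G\<^esub> k"
    using gen[OF z] nontrivial_power z by metis
  have "f z [^]\<^bsub>H\<^esub> (int n + 1) \<in> f ` (\<lambda>j. x [^]\<^bsub>G\<^esub> j) ` {j. j dvd k}" for n :: nat
  proof -
    obtain v where v: "v \<in> carrier G" "v \<noteq> \<one>\<^bsub>G\<^esub>" "f v = f z [^]\<^bsub>H\<^esub> (int n + 1)" "generates G v z"
      using reverses_image_power[OF z(1,2) rev, of "int n + 1"] by auto
    have "commensurable G x v"
      by (rule G.commensurable_trans[OF x(1) z(1) v(1) z(3)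
            commensurable_sym[OF G.generates_commensurable[OF v(1,4) z(2)]]])
    then obtain j :: int where j: "v = x [^]\<^bsub>G\<^esub> j" using gen v generates_def by metis
    then have "j dvd k"
      using v k G.infinite_order_generates infinite_order x by metis
    then show ?thesis using j v(3) by (metis (mono_tags) imageI mem_Collect_eq)
  qed
  then have "range (\<lambda>n::nat. f z [^]\<^bsub>H\<^esub> (int n + 1)) \<subseteq> f ` (\<lambda>j. x [^]\<^bsub>G\<^esub> j) ` {j. j dvd k}"
    by blast
  moreover have "finite {j. j dvd k}" using k finite_divisors_int by simp
  ultimately have "finite (range (\<lambda>n::nat. f z [^]\<^bsub>H\<^esub> (int n + 1)))"
    by (meson finite_imageI finite_subset)
  moreover have "inj (\<lambda>n::nat. f z [^]\<^bsub>H\<^esub> (int n + 1))"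
    using z by (auto simp: inj_on_def H.infinite_order_inj image_infinite_order)
  ultimately show False using finite_imageD infinite_UNIV_nat by blast
qed

lemma commensurable_preserves:
  assumes x: "x \<in> carrier G" "x \<noteq> \<one>\<^bsub>G\<^esub>" and v: "v \<in> carrier G" "v \<noteq> \<one>\<^bsub>G\<^esub>"
    and xv: "commensurable G x v"
  shows "preserves x \<longleftrightarrow> preserves v"
proof (cases "\<exists>d. (d = x \<or> d = v) \<and>
    (\<forall>u \<in> carrier G. u \<noteq> \<one>\<^bsub>G\<^esub> \<longrightarrow> commensurable G d u \<longrightarrow> comparable G d u)")
  case True
  then obtain d where d: "d \<in> carrier G" "d \<noteq> \<one>\<^bsub>G\<^esub>" "commensurable G d x" "commensurable G d v"
    "\<And>u. u \<in> carrier G \<Longrightarrow> u \<noteq> \<one>\<^bsub>G\<^esub> \<Longrightarrow> commensurable G d u \<Longrightarrow> comparable G d u"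
    using x v xv commensurable_sym G.commensurable_refl by metis
  then show ?thesis using dominating_preserves[OF d(1,2,5)] x v by blast
next
  case False
  obtain a b :: int where ab: "a \<noteq> 0" "b \<noteq> 0" "x [^]\<^bsub>G\<^esub> a = v [^]\<^bsub>G\<^esub> b"
    using xv unfolding commensurable_def by blast
  have "preserves (x [^]\<^bsub>G\<^esub> a) \<longleftrightarrow> preserves x" "preserves (v [^]\<^bsub>G\<^esub> b) \<longleftrightarrow> preserves v"
    using False power_preserves[OF x] power_preserves[OF v] ab by blast+
  then show ?thesis using ab by simp
qed

lemma reverses_commensurable:
  assumes "x \<in> carrier G" "x \<noteq> \<one>\<^bsub>G\<^esub>" "reverses x"
    and "v \<in> carrier G" "v \<noteq> \<one>\<^bsub>G\<^esub>" "commensurable G x v"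
  shows "reverses v"
  using assms commensurable_preserves reverses_iff_not_preserves by metis

section \<open>A reversed commensurability class is a copy of the nonzero rationals\<close>

text \<open>The images of \<open>x\<close> and \<open>v\<close> are powers of the image of a common power \<open>z\<close> of \<open>x\<close> and \<open>v\<close>, and powers of
  one element have a common power. Reversal turns the latter into a common root.\<close>

lemma common_root:
  assumes x: "x \<in> carrier G" "x \<noteq> \<one>\<^bsub>G\<^esub>" "reverses x"
    and v: "v \<in> carrier G" "v \<noteq> \<one>\<^bsub>G\<^esub>" "commensurable G x v"
  obtains u where "u \<in> carrier G" "u \<noteq> \<one>\<^bsub>G\<^esub>" "generates G u x" "generates G u v"
proof -
  obtain a b :: int where ab: "a \<noteq> 0" "b \<noteq> 0" "x [^]\<^bsub>G\<^esub> a = v [^]\<^bsub>G\<^esub> b"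
    using v unfolding commensurable_def by blast
  define z where "z = x [^]\<^bsub>G\<^esub> a"
  have z: "z \<in> carrier G" "z \<noteq> \<one>\<^bsub>G\<^esub>" "generates G x z" "generates G v z"
    using x(1) ab(1) pow_eq_one_iff[OF x(1,2)] G.generates_pow[of v b]
    by (simp_all add: z_def flip: ab(3))
  have vr: "reverses v" by (rule reverses_commensurable[OF x v])
  have zr: "reverses z"
    by (rule reverses_commensurable[OF x z(1,2) G.generates_commensurable[OF x(1) z(3,2)]])
  obtain s :: int where s: "f x = f z [^]\<^bsub>H\<^esub> s"
    using reversesD[OF x(3) z(3,2)] generates_def by metis
  obtain t :: int where t: "f v = f z [^]\<^bsub>H\<^esub> t"
    using reversesD[OF vr z(4,2)] generates_def by metis
  have "s \<noteq> 0" "t \<noteq> 0"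
    using s t f_eq_one_iff[OF x(1)] f_eq_one_iff[OF v(1)] x(2) v(2) by auto
  then have "s * t \<noteq> 0" by simp
  then obtain u where u: "u \<in> carrier G" "u \<noteq> \<one>\<^bsub>G\<^esub>" "f u = f z [^]\<^bsub>H\<^esub> (s * t)" "generates G u z"
    by (rule reverses_image_power[OF z(1,2) zr])
  have ur: "reverses u"
    by (rule reverses_commensurable[OF z(1,2) zr u(1,2)
          commensurable_sym[OF G.generates_commensurable[OF u(1,4) z(2)]]])
  have "f u = f x [^]\<^bsub>H\<^esub> t" "f u = f v [^]\<^bsub>H\<^esub> s"
    using z u s t by (simp_all add: H.int_pow_pow mult.commute)
  then have "generates H (f x) (f u)" "generates H (f v) (f u)"
    unfolding generates_def by blast+
  then have "generates G u x" "generates G u v"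
    using reverses_iff[OF x u(1,2) ur] reverses_iff[OF v(1,2) vr u(1,2) ur] by simp_all
  then show thesis using that u by metis
qed

lemma unique_root:
  assumes x: "x \<in> carrier G" "x \<noteq> \<one>\<^bsub>G\<^esub>" "reverses x" and v: "v \<in> carrier G"
    and n: "n \<noteq> (0::int)" and eq: "x [^]\<^bsub>G\<^esub> n = v [^]\<^bsub>G\<^esub> n"
  shows "x = v"
proof -
  have v1: "v \<noteq> \<one>\<^bsub>G\<^esub>" using eq n x pow_eq_one_iff by auto
  have "commensurable G x v" using n eq unfolding commensurable_def by metis
  then obtain u where u: "u \<in> carrier G" "u \<noteq> \<one>\<^bsub>G\<^esub>" "generates G u x" "generates G u v"
    by (rule common_root[OF x v v1])
  obtain a b :: int where ab: "x = u [^]\<^bsub>G\<^esub> a" "v = u [^]\<^bsub>G\<^esub> b"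
    using u unfolding generates_def by blast
  have "u [^]\<^bsub>G\<^esub> (a * n) = u [^]\<^bsub>G\<^esub> (b * n)"
    using eq ab u(1) by (simp add: G.int_pow_pow)
  then have "a * n = b * n"
    using G.infinite_order_inj[OF infinite_order[OF u(1,2)] u(1)] by blast
  then show ?thesis using ab n by simp
qed

text \<open>Write \<open>z = x\<^sup>p\<close>. The powers of \<open>f z\<close> are the images of the roots of \<open>z\<close>, and the step from \<open>x\<close> to
  \<open>z\<close> being minimal, \<open>f x = (f z)\<^sup>q\<close> for a prime \<open>q\<close>. Let \<open>v\<close> be the root of \<open>x\<close> with
  \<open>f v = (f z)\<^sup>q\<^sup>q\<close>. Between \<open>v\<close> and \<open>z\<close> there is, up to inverses, only \<open>x\<close>, as between \<open>q\<^sup>2\<close> and 1 there is only the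
  divisor \<open>q\<close>. If \<open>x = v\<^sup>k\<close> with \<open>k\<close> prime to \<open>p\<close>, then \<open>v\<^sup>p\<close> would lie there too and differ from \<open>x\<close>.\<close>

lemma prime_root:
  assumes x: "x \<in> carrier G" "x \<noteq> \<one>\<^bsub>G\<^esub>" "reverses x" and p: "prime (p::int)"
  shows "\<exists>v \<in> carrier G. v [^]\<^bsub>G\<^esub> p = x"
proof -
  have p0: "p \<noteq> 0" "\<not> p dvd 1" using p by (auto simp: zdvd1_eq)
  have rev: "u \<noteq> \<one>\<^bsub>G\<^esub> \<Longrightarrow> comparable G x u \<Longrightarrow> reverses u" if "u \<in> carrier G" for u
    using reverses_commensurable[OF x that] G.comparable_commensurable[OF x(1) that] x(2) by metis
  define z where "z = x [^]\<^bsub>G\<^esub> p"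
  have z: "z \<in> carrier G" "z \<noteq> \<one>\<^bsub>G\<^esub>" "generates G x z"
    using x p0 pow_eq_one_iff by (simp_all add: z_def)
  have zr: "reverses z" using rev z comparable_def by metis
  define g where "g = f z"
  have g: "g \<in> carrier H" "infinite_order H g"
    using z image_infinite_order by (simp_all add: g_def)
  obtain q :: int where q: "f x = g [^]\<^bsub>H\<^esub> q"
    using reversesD[OF x(3) z(3,2)] generates_def g_def by metis
  have q0: "q \<noteq> 0" using q f_eq_one_iff[OF x(1)] x(2) by auto
  have xinf: "generates G (x [^]\<^bsub>G\<^esub> a) (x [^]\<^bsub>G\<^esub> b) \<longleftrightarrow> a dvd b" for a b :: int
    using G.infinite_order_generates infinite_order x by blast
  have q1: "\<not> q dvd 1"
  proof
    assume "q dvd 1"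
    then have "generates H (f x) (f z)"
      using H.unit_power_generates[OF g(1)] q g_def by metis
    then have "generates G z x" using reverses_iff[OF x z(1,2) zr] by blast
    then show False using xinf[of p 1] p0 x by (simp add: z_def)
  qed
  have "irreducible q"
  proof (rule irreducibleI[OF q0 q1])
    fix d e assume de: "q = d * e"
    then have "d \<noteq> 0" using q0 by auto
    then obtain w where w: "w \<in> carrier G" "w \<noteq> \<one>\<^bsub>G\<^esub>" "f w = f z [^]\<^bsub>H\<^esub> d" "generates G w z"
      by (rule reverses_image_power[OF z(1,2) zr])
    have wr: "reverses w"
      by (rule reverses_commensurable[OF z(1,2) zr w(1,2)
            commensurable_sym[OF G.generates_commensurable[OF w(1,4) z(2)]]])
    have "generates H (f w) (f x)"
      using w q de g H.infinite_order_generates by (simp add: g_def)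
    then have "generates G x w" using reverses_iff[OF w(1,2) wr x] by blast
    then obtain j :: int where j: "w = x [^]\<^bsub>G\<^esub> j" using generates_def by metis
    then have "j dvd p" using w(4) xinf by (simp add: z_def)
    then have "j dvd 1 \<or> p dvd j"
      using p by (metis irreducibleD' prime_elem_imp_irreducible prime_def)
    then show "d dvd 1 \<or> e dvd 1"
    proof
      assume "j dvd 1"
      then have "generates G w x" using G.unit_power_generates x j by blast
      then have "generates H (f x) (f w)" using reverses_iff[OF x w(1,2) wr] by blast
      then have "q dvd d" using w q g H.infinite_order_generates g_def by metis
      then show ?thesis using de \<open>d \<noteq> 0\<close> by auto
    next
      assume "p dvd j"
      then have "generates G z w" using xinf j by (simp add: z_def)
      then have "generates H (f w) (f z)" using reverses_iff[OF w(1,2) wr z(1,2) zr] by blast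
      then have "generates H (g [^]\<^bsub>H\<^esub> d) (g [^]\<^bsub>H\<^esub> (1::int))" using w g by (simp add: g_def)
      then show ?thesis using g H.infinite_order_generates by blast
    qed
  qed
  then have qprime: "prime_elem q" by (rule irreducible_imp_prime_elem)
  have "q * q \<noteq> 0" using q0 by simp
  then obtain v where v: "v \<in> carrier G" "v \<noteq> \<one>\<^bsub>G\<^esub>" "f v = f z [^]\<^bsub>H\<^esub> (q * q)" "generates G v z"
    by (rule reverses_image_power[OF z(1,2) zr])
  have vr: "reverses v"
    by (rule reverses_commensurable[OF z(1,2) zr v(1,2)
          commensurable_sym[OF G.generates_commensurable[OF v(1,4) z(2)]]])
  have ginf: "generates H (g [^]\<^bsub>H\<^esub> a) (g [^]\<^bsub>H\<^esub> b) \<longleftrightarrow> a dvd b" for a b :: int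
    using H.infinite_order_generates g by blast
  have vinf: "generates G (v [^]\<^bsub>G\<^esub> a) (v [^]\<^bsub>G\<^esub> b) \<longleftrightarrow> a dvd b" for a b :: int
    using G.infinite_order_generates infinite_order v by blast
  have "generates H (f x) (f v)" unfolding q v(3) using ginf by (simp add: g_def)
  then have "generates G v x" using reverses_iff[OF x v(1,2) vr] by blast
  then obtain k :: int where k: "k \<noteq> 0" "x = v [^]\<^bsub>G\<^esub> k" using nontrivial_power x(2) by metis
  have k1: "\<not> k dvd 1"
  proof
    assume "k dvd 1"
    then have "generates G x v" using G.unit_power_generates v k by blast
    then have "generates H (f v) (f x)" using reverses_iff[OF v(1,2) vr x] by blast
    then have "q * q dvd q" using ginf v(3) q g_def by metis
    then show False using q0 q1 by (metis dvd_times_right_cancel_iff mult_1)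
  qed
  have "p dvd k"
  proof (rule ccontr)
    assume "\<not> p dvd k"
    then have cop: "coprime p k" using p by (simp add: prime_imp_coprime)
    define w where "w = v [^]\<^bsub>G\<^esub> p"
    have w: "w \<in> carrier G" "w \<noteq> \<one>\<^bsub>G\<^esub>" "generates G v w"
      using v p0 pow_eq_one_iff by (simp_all add: w_def)
    have wr: "reverses w"
      by (rule reverses_commensurable[OF v(1,2) vr w(1,2) G.generates_commensurable[OF v(1) w(3,2)]])
    have zv: "z = v [^]\<^bsub>G\<^esub> (k * p)" using k v by (simp add: z_def G.int_pow_pow)
    have "generates G w z" unfolding zv w_def vinf by simp
    then have "generates H (f z) (f w)" using reverses_iff[OF z(1,2) zr w(1,2) wr] by blast
    then obtain t :: int where t: "f w = g [^]\<^bsub>H\<^esub> t" using generates_def g_def by metis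
    have "\<not> generates G w x"
      unfolding k w_def vinf using coprime_nonunits_incomparable(1)[OF cop p0(2) k1] .
    then have "\<not> generates H (f x) (f w)" using reverses_iff[OF x w(1,2) wr] by blast
    then have "\<not> q dvd t" unfolding q t ginf .
    then have "coprime q t" using qprime by (simp add: prime_elem_imp_coprime)
    then have "coprime t (q * q)" by (simp add: coprime_commute)
    moreover have "generates H (f w) (f v)" using reversesD[OF vr w(3,2)] .
    then have "t dvd q * q" unfolding t v(3) using ginf by (simp add: g_def)
    ultimately have "t dvd 1" by (metis coprime_absorb_left)
    then have "generates H (f w) (f z)" using H.unit_power_generates[OF g(1)] t g_def by metis
    then have "generates G z w" using reverses_iff[OF w(1,2) wr z(1,2) zr] by blast
    then have "k * p dvd p" unfolding zv w_def vinf .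
    then show False using p0 k1 by (metis dvd_times_right_cancel_iff mult_1)
  qed
  then obtain l where "k = l * p" by (metis dvd_def mult.commute)
  then have "(v [^]\<^bsub>G\<^esub> l) [^]\<^bsub>G\<^esub> p = x" using k v by (simp add: G.int_pow_pow)
  then show ?thesis using v by (metis G.int_pow_closed)
qed

lemma root:
  fixes n :: int
  assumes "n \<noteq> 0" "x \<in> carrier G" "x \<noteq> \<one>\<^bsub>G\<^esub>" "reverses x"
  shows "\<exists>v \<in> carrier G. v [^]\<^bsub>G\<^esub> n = x"
  using assms
proof (induction n arbitrary: x rule: prime_divisors_induct)
  case zero
  then show ?case by simp
next
  case (unit n)
  then have "n * n = 1" by (metis abs_mult_self_eq mult_1 zdvd1_eq)
  then have "(x [^]\<^bsub>G\<^esub> n) [^]\<^bsub>G\<^esub> n = x" using unit by (simp add: G.int_pow_pow)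
  then show ?case using unit by (metis G.int_pow_closed)
next
  case (factor p n)
  have pn: "p \<noteq> 0" "n \<noteq> 0" using factor.prems by auto
  obtain v where v: "v \<in> carrier G" "v [^]\<^bsub>G\<^esub> p = x"
    using prime_root factor by blast
  have v1: "v \<noteq> \<one>\<^bsub>G\<^esub>" using v factor.prems by auto
  have "commensurable G x v"
    using G.commensurable_pow[OF v(1) pn(1)] v(2) commensurable_sym by metis
  then have "reverses v"
    using reverses_commensurable[OF factor.prems(2-4) v(1) v1] by blast
  then obtain w where w: "w \<in> carrier G" "w [^]\<^bsub>G\<^esub> n = v"
    using factor.IH[OF pn(2) v(1) v1] by blast
  then have "w [^]\<^bsub>G\<^esub> (p * n) = x"
    using v by (metis G.int_pow_pow mult.commute)
  then show ?case using w by blast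
qed

text \<open>If \<open>x\<close> corresponds to the rational \<open>a/b\<close>, with \<open>c\<close> corresponding to 1, then its reciprocal
  corresponds to \<open>b/a\<close>.\<close>

definition reciprocal :: "'a \<Rightarrow> 'a \<Rightarrow> 'a" where
  "reciprocal c x = (SOME w. w \<in> carrier G \<and> (\<exists>(a::int) (b::int). a \<noteq> 0 \<and> b \<noteq> 0 \<and>
    x [^]\<^bsub>G\<^esub> b = c [^]\<^bsub>G\<^esub> a \<and> w [^]\<^bsub>G\<^esub> a = c [^]\<^bsub>G\<^esub> b))"

lemma reciprocal_unique:
  fixes a b a' b' :: int
  assumes c: "c \<in> carrier G" "c \<noteq> \<one>\<^bsub>G\<^esub>" "reverses c"
    and x: "x \<in> carrier G" and w: "w \<in> carrier G" "w' \<in> carrier G"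
    and ab: "a \<noteq> 0" "b \<noteq> 0" "x [^]\<^bsub>G\<^esub> b = c [^]\<^bsub>G\<^esub> a" "w [^]\<^bsub>G\<^esub> a = c [^]\<^bsub>G\<^esub> b"
    and ab': "a' \<noteq> 0" "b' \<noteq> 0" "x [^]\<^bsub>G\<^esub> b' = c [^]\<^bsub>G\<^esub> a'" "w' [^]\<^bsub>G\<^esub> a' = c [^]\<^bsub>G\<^esub> b'"
  shows "w = w'"
proof -
  have "c [^]\<^bsub>G\<^esub> (a * b') = x [^]\<^bsub>G\<^esub> (b * b')" using c x ab(3) by (metis G.int_pow_pow)
  also have "\<dots> = c [^]\<^bsub>G\<^esub> (a' * b)" using c x ab'(3) by (metis G.int_pow_pow mult.commute)
  finally have eq: "a * b' = a' * b"
    using G.infinite_order_inj[OF infinite_order[OF c(1,2)] c(1)] by blast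
  have "w [^]\<^bsub>G\<^esub> (a * a') = c [^]\<^bsub>G\<^esub> (b * a')" using c w ab(4) by (metis G.int_pow_pow)
  also have "\<dots> = c [^]\<^bsub>G\<^esub> (b' * a)" using eq by (simp add: mult.commute)
  also have "\<dots> = w' [^]\<^bsub>G\<^esub> (a * a')" using c w ab'(4) by (metis G.int_pow_pow mult.commute)
  finally have "w [^]\<^bsub>G\<^esub> (a * a') = w' [^]\<^bsub>G\<^esub> (a * a')" .
  moreover have w1: "w \<noteq> \<one>\<^bsub>G\<^esub>"
    using ab(2,4) pow_eq_one_iff[OF c(1,2), of b] by auto
  moreover have "commensurable G c w" using ab unfolding commensurable_def by metis
  then have "reverses w" by (rule reverses_commensurable[OF c w(1) w1])
  ultimately show ?thesis using unique_root[of w w' "a * a'"] w ab ab' by simp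
qed

lemma reciprocal_eqI:
  fixes a b :: int
  assumes c: "c \<in> carrier G" "c \<noteq> \<one>\<^bsub>G\<^esub>" "reverses c"
    and x: "x \<in> carrier G" and w: "w \<in> carrier G"
    and ab: "a \<noteq> 0" "b \<noteq> 0" "x [^]\<^bsub>G\<^esub> b = c [^]\<^bsub>G\<^esub> a" "w [^]\<^bsub>G\<^esub> a = c [^]\<^bsub>G\<^esub> b"
  shows "reciprocal c x = w"
  unfolding reciprocal_def
proof (rule some_equality)
  show "w \<in> carrier G \<and> (\<exists>(a::int) (b::int). a \<noteq> 0 \<and> b \<noteq> 0 \<and>
    x [^]\<^bsub>G\<^esub> b = c [^]\<^bsub>G\<^esub> a \<and> w [^]\<^bsub>G\<^esub> a = c [^]\<^bsub>G\<^esub> b)" using w ab by metis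
qed (use reciprocal_unique[OF c x _ w _ _ _ _ ab] in blast)

lemma reciprocal_spec:
  assumes c: "c \<in> carrier G" "c \<noteq> \<one>\<^bsub>G\<^esub>" "reverses c"
    and x: "x \<in> carrier G" "commensurable G c x"
  obtains a b :: int where "a \<noteq> 0" "b \<noteq> 0" "x [^]\<^bsub>G\<^esub> b = c [^]\<^bsub>G\<^esub> a"
    "reciprocal c x [^]\<^bsub>G\<^esub> a = c [^]\<^bsub>G\<^esub> b" "reciprocal c x \<in> carrier G"
proof -
  obtain a b :: int where ab: "a \<noteq> 0" "b \<noteq> 0" "x [^]\<^bsub>G\<^esub> b = c [^]\<^bsub>G\<^esub> a"
    using x unfolding commensurable_def by metis
  have cb: "c [^]\<^bsub>G\<^esub> b \<in> carrier G" "c [^]\<^bsub>G\<^esub> b \<noteq> \<one>\<^bsub>G\<^esub>" using c ab pow_eq_one_iff by auto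
  have "reverses (c [^]\<^bsub>G\<^esub> b)"
    by (rule reverses_commensurable[OF c cb G.commensurable_pow[OF c(1) ab(2)]])
  then obtain w where w: "w \<in> carrier G" "w [^]\<^bsub>G\<^esub> a = c [^]\<^bsub>G\<^esub> b"
    using root[OF ab(1) cb] by blast
  then have "reciprocal c x = w" using reciprocal_eqI[OF c x(1) w(1) ab] by blast
  then show thesis using that ab w by metis
qed

lemma reciprocal_commensurable:
  assumes c: "c \<in> carrier G" "c \<noteq> \<one>\<^bsub>G\<^esub>" "reverses c"
    and x: "x \<in> carrier G" "commensurable G c x"
  shows "reciprocal c x \<in> carrier G" "reciprocal c x \<noteq> \<one>\<^bsub>G\<^esub>" "commensurable G c (reciprocal c x)"
    "reciprocal c (reciprocal c x) = x"
proof -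
  obtain a b :: int where ab: "a \<noteq> 0" "b \<noteq> 0" "x [^]\<^bsub>G\<^esub> b = c [^]\<^bsub>G\<^esub> a"
    "reciprocal c x [^]\<^bsub>G\<^esub> a = c [^]\<^bsub>G\<^esub> b" and r: "reciprocal c x \<in> carrier G"
    by (rule reciprocal_spec[OF c x])
  show "reciprocal c x \<in> carrier G" by (rule r)
  show "reciprocal c x \<noteq> \<one>\<^bsub>G\<^esub>"
    using ab(2,4) pow_eq_one_iff[OF c(1,2), of b] by auto
  show "commensurable G c (reciprocal c x)" using ab unfolding commensurable_def by metis
  show "reciprocal c (reciprocal c x) = x"
    by (rule reciprocal_eqI[OF c r x(1) ab(2,1,4,3)])
qed

text \<open>With \<open>x\<close> corresponding to \<open>a/b\<close> and \<open>z = x\<^sup>n\<close> to \<open>an/b\<close>, a root \<open>r'\<close> of \<open>c\<^sup>b\<close> of degree \<open>an\<close>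
  represents the reciprocal of \<open>z\<close>, and visibly \<open>r'\<^sup>n\<close> that of \<open>x\<close>.\<close>

lemma reciprocal_antitone:
  assumes c: "c \<in> carrier G" "c \<noteq> \<one>\<^bsub>G\<^esub>" "reverses c"
    and x: "x \<in> carrier G" "commensurable G c x"
    and z: "generates G x z" "z \<noteq> \<one>\<^bsub>G\<^esub>"
  shows "generates G (reciprocal c z) (reciprocal c x)"
proof -
  obtain n :: int where n: "n \<noteq> 0" "z = x [^]\<^bsub>G\<^esub> n" using nontrivial_power z by metis
  have zc: "z \<in> carrier G" using n x by simp
  have "commensurable G c z"
    by (rule G.commensurable_trans[OF c(1) x(1) zc x(2) G.generates_commensurable[OF x(1) z]])
  then have r: "reciprocal c z \<in> carrier G"
    by (rule reciprocal_commensurable(1)[OF c zc])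
  obtain a b :: int where ab: "a \<noteq> 0" "b \<noteq> 0" "x [^]\<^bsub>G\<^esub> b = c [^]\<^bsub>G\<^esub> a"
    "reciprocal c x [^]\<^bsub>G\<^esub> a = c [^]\<^bsub>G\<^esub> b" and rx: "reciprocal c x \<in> carrier G"
    by (rule reciprocal_spec[OF c x])
  have an: "a * n \<noteq> 0" using ab n by simp
  have zb: "z [^]\<^bsub>G\<^esub> b = c [^]\<^bsub>G\<^esub> (a * n)"
    using n x c ab(3) by (metis G.int_pow_pow mult.commute)
  have cb: "c [^]\<^bsub>G\<^esub> b \<in> carrier G" "c [^]\<^bsub>G\<^esub> b \<noteq> \<one>\<^bsub>G\<^esub>" using c ab pow_eq_one_iff by auto
  have "reverses (c [^]\<^bsub>G\<^esub> b)"
    by (rule reverses_commensurable[OF c cb G.commensurable_pow[OF c(1) ab(2)]])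
  then obtain r' where r': "r' \<in> carrier G" "r' [^]\<^bsub>G\<^esub> (a * n) = c [^]\<^bsub>G\<^esub> b"
    using root[OF an cb] by blast
  have "reciprocal c z = r'" by (rule reciprocal_eqI[OF c zc r'(1) an ab(2) zb r'(2)])
  moreover have "(r' [^]\<^bsub>G\<^esub> n) [^]\<^bsub>G\<^esub> a = c [^]\<^bsub>G\<^esub> b"
    using r' by (simp add: G.int_pow_pow mult.commute)
  then have "reciprocal c x = r' [^]\<^bsub>G\<^esub> n"
    using reciprocal_eqI[OF c x(1) _ ab(1,2,3)] r'(1) by simp
  ultimately show ?thesis by simp
qed

section \<open>Straightening the reversed classes\<close>

definition base :: "'a \<Rightarrow> 'a" where
  "base x = (SOME c. c \<in> carrier G \<and> c \<noteq> \<one>\<^bsub>G\<^esub> \<and> commensurable G x c)"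

lemma base_props:
  assumes "x \<in> carrier G" "x \<noteq> \<one>\<^bsub>G\<^esub>"
  shows "base x \<in> carrier G" "base x \<noteq> \<one>\<^bsub>G\<^esub>" "commensurable G x (base x)"
  using assms someI[of "\<lambda>c. c \<in> carrier G \<and> c \<noteq> \<one>\<^bsub>G\<^esub> \<and> commensurable G x c" x]
  unfolding base_def by auto

lemma base_cong:
  assumes "x \<in> carrier G" "z \<in> carrier G" "commensurable G x z"
  shows "base x = base z"
proof -
  have "commensurable G x c \<longleftrightarrow> commensurable G z c" if "c \<in> carrier G" for c
    using assms that G.commensurable_trans commensurable_sym by metis
  then have "(\<lambda>c. c \<in> carrier G \<and> c \<noteq> \<one>\<^bsub>G\<^esub> \<and> commensurable G x c) =
      (\<lambda>c. c \<in> carrier G \<and> c \<noteq> \<one>\<^bsub>G\<^esub> \<and> commensurable G z c)" by blast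
  then show ?thesis unfolding base_def by simp
qed

text \<open>On a reversed class, \<open>f\<close> reverses all arcs and so does the reciprocal; composing the two keeps them.\<close>

definition straighten :: "'a \<Rightarrow> 'a" where
  "straighten x = (if x \<noteq> \<one>\<^bsub>G\<^esub> \<and> reverses x then reciprocal (base x) x else x)"

lemma straighten_one [simp]: "straighten \<one>\<^bsub>G\<^esub> = \<one>\<^bsub>G\<^esub>"
  by (simp add: straighten_def)

lemma straighten_props:
  assumes x: "x \<in> carrier G" "x \<noteq> \<one>\<^bsub>G\<^esub>"
  shows "straighten x \<in> carrier G" "straighten x \<noteq> \<one>\<^bsub>G\<^esub>" "commensurable G x (straighten x)"
    "straighten (straighten x) = x"
proof -
  have "straighten x \<in> carrier G \<and> straighten x \<noteq> \<one>\<^bsub>G\<^esub> \<and> commensurable G x (straighten x) \<and>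
    straighten (straighten x) = x"
  proof (cases "reverses x")
    case False
    then show ?thesis using x by (simp add: straighten_def)
  next
    case True
    let ?c = "base x" and ?r = "reciprocal (base x) x"
    note c = base_props(1,2)[OF x] reverses_commensurable[OF x True base_props[OF x]]
    note xc = commensurable_sym[OF base_props(3)[OF x]]
    note r = reciprocal_commensurable[OF c x(1) xc]
    have xr: "commensurable G x ?r"
      by (rule G.commensurable_trans[OF x(1) c(1) r(1) base_props(3)[OF x] r(3)])
    have "reverses ?r" by (rule reverses_commensurable[OF x True r(1,2) xr])
    moreover have "base ?r = ?c" using base_cong[OF x(1) r(1) xr] by simp
    ultimately show ?thesis using True x r xr by (simp add: straighten_def)
  qed
  then show "straighten x \<in> carrier G" "straighten x \<noteq> \<one>\<^bsub>G\<^esub>" "commensurable G x (straighten x)"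
    "straighten (straighten x) = x" by blast+
qed

lemma straighten_bij: "bij_betw straighten (carrier G) (carrier G)"
proof (rule bij_betw_byWitness[where f' = straighten])
  have *: "straighten x \<in> carrier G \<and> straighten (straighten x) = x" if "x \<in> carrier G" for x
    using straighten_props[OF that] that by (cases "x = \<one>\<^bsub>G\<^esub>") auto
  then show "\<forall>x \<in> carrier G. straighten (straighten x) = x"
    "\<forall>x \<in> carrier G. straighten (straighten x) = x"
    "straighten ` carrier G \<subseteq> carrier G" "straighten ` carrier G \<subseteq> carrier G" by auto
qed

lemma straightened_generates_commensurable:
  assumes x: "x \<in> carrier G" "x \<noteq> \<one>\<^bsub>G\<^esub>" and z: "z \<in> carrier G" "z \<noteq> \<one>\<^bsub>G\<^esub>"
    and xz: "commensurable G x z"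
  shows "generates H (f (straighten x)) (f (straighten z)) \<longleftrightarrow> generates G x z"
proof (cases "reverses x")
  case False
  then have "preserves x" "preserves z"
    using preserves_or_reverses[OF x] commensurable_preserves[OF x z xz] by auto
  moreover from this have "\<not> reverses z" using not_preserves_and_reverses[OF z] by blast
  ultimately show ?thesis using False preserves_iff[OF x _ z] by (simp add: straighten_def)
next
  case True
  have zr: "reverses z" by (rule reverses_commensurable[OF x True z xz])
  let ?c = "base x"
  note c = base_props(1,2)[OF x] reverses_commensurable[OF x True base_props[OF x]]
  note cx = commensurable_sym[OF base_props(3)[OF x]]
  have cz: "commensurable G ?c z" by (rule G.commensurable_trans[OF c(1) x(1) z(1) cx xz])
  have eq: "straighten x = reciprocal ?c x" "straighten z = reciprocal ?c z"
    using x z True zr base_cong[OF x(1) z(1) xz] by (simp_all add: straighten_def)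
  note rx = reciprocal_commensurable[OF c x(1) cx] and rz = reciprocal_commensurable[OF c z(1) cz]
  have "reverses (reciprocal ?c x)" "reverses (reciprocal ?c z)"
    by (rule reverses_commensurable[OF c rx(1-3)], rule reverses_commensurable[OF c rz(1-3)])
  then have "generates H (f (straighten x)) (f (straighten z)) \<longleftrightarrow>
      generates G (reciprocal ?c z) (reciprocal ?c x)"
    unfolding eq using reverses_iff[OF rx(1,2) _ rz(1,2)] by blast
  also have "\<dots> \<longleftrightarrow> generates G x z"
    using reciprocal_antitone[OF c x(1) cx, of z] z(2)
      reciprocal_antitone[OF c rz(1,3), of "reciprocal ?c x"] rx(2,4) rz(4) by auto
  finally show ?thesis .
qed

lemma straightened_generates_iff:
  assumes x: "x \<in> carrier G" and z: "z \<in> carrier G"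
  shows "generates H (f (straighten x)) (f (straighten z)) \<longleftrightarrow> generates G x z"
proof -
  consider "z = \<one>\<^bsub>G\<^esub>" | "x = \<one>\<^bsub>G\<^esub>" "z \<noteq> \<one>\<^bsub>G\<^esub>" | "x \<noteq> \<one>\<^bsub>G\<^esub>" "z \<noteq> \<one>\<^bsub>G\<^esub>" by blast
  then show ?thesis
  proof cases
    case 1
    then show ?thesis by (simp add: f_one)
  next
    case 2
    then show ?thesis
      using straighten_props[OF z] f_eq_one_iff
      by (simp add: f_one G.one_generates_iff H.one_generates_iff)
  next
    case 3
    note sx = straighten_props[OF x 3(1)] and sz = straighten_props[OF z 3(2)]
    show ?thesis
    proof (cases "commensurable G x z")
      case True
      then show ?thesis using straightened_generates_commensurable x z 3 by blast
    next
      case False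
      have "\<not> generates G x z" using False G.generates_commensurable[OF x _ 3(2)] by blast
      moreover have "\<not> generates H (f (straighten x)) (f (straighten z))"
      proof
        assume "generates H (f (straighten x)) (f (straighten z))"
        then have "comparable G (straighten x) (straighten z)"
          using comparable_iff[OF sx(1) sz(1)] comparable_def by metis
        then have "commensurable G (straighten x) (straighten z)"
          by (rule G.comparable_commensurable[OF sx(1) sz(1) _ sx(2) sz(2)])
        then have "commensurable G x (straighten z)"
          by (rule G.commensurable_trans[OF x sx(1) sz(1) sx(3)])
        then have "commensurable G x z"
          by (rule G.commensurable_trans[OF x sz(1) z _ commensurable_sym[OF sz(3)]])
        then show False using False by blast
      qed
      ultimately show ?thesis by blast
    qed
  qed
qed

theorem directed_isomorphism_exists:
  "\<exists>g. bij_betw g (carrier G) (carrier H) \<and>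
    (\<forall>x \<in> carrier G. \<forall>z \<in> carrier G. generates H (g x) (g z) \<longleftrightarrow> generates G x z)"
proof (intro exI conjI ballI)
  show "bij_betw (f \<circ> straighten) (carrier G) (carrier H)"
    by (rule bij_betw_trans[OF straighten_bij bij])
qed (simp add: straightened_generates_iff)

end

section \<open>From digraph isomorphisms to power graph isomorphisms\<close>

lemma torsion_free_infinite_order:
  assumes "group G" "torsion_free G" "x \<in> carrier G" "x \<noteq> \<one>\<^bsub>G\<^esub>"
  shows "infinite_order G x"
  unfolding infinite_order_def
proof (intro allI impI)
  interpret group G by (rule assms(1))
  fix n :: int assume n: "x [^]\<^bsub>G\<^esub> n = \<one>\<^bsub>G\<^esub>"
  then have "x [^]\<^bsub>G\<^esub> (- n) = \<one>\<^bsub>G\<^esub>" using assms(3) by (simp add: int_pow_neg)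
  then have "x [^]\<^bsub>G\<^esub> (int (nat \<bar>n\<bar>)) = \<one>\<^bsub>G\<^esub>" using n by (simp add: abs_if)
  then have "x [^]\<^bsub>G\<^esub> nat \<bar>n\<bar> = \<one>\<^bsub>G\<^esub>" by (simp only: int_pow_int)
  then have "\<not> nat \<bar>n\<bar> > 0" using assms unfolding torsion_free_def by blast
  then show "n = 0" by simp
qed

lemma arc_power_graph:
  "(x, y) \<in> parcs (power_graph G) \<longleftrightarrow>
    x \<in> carrier G \<and> y \<in> carrier G \<and> x \<noteq> y \<and> comparable G x y"
  by (auto simp: power_graph_def comparable_def generates_def)

lemma arc_directed_power_graph:
  "(x, y) \<in> parcs (directed_power_graph G) \<longleftrightarrow>
    x \<in> carrier G \<and> y \<in> carrier G \<and> x \<noteq> y \<and> generates G x y"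
  by (auto simp: directed_power_graph_def generates_def)

text \<open>The identity of \<open>G\<close> and the preimage \<open>d\<close> of the identity of \<open>H\<close> are both adjacent to every vertex, so
  exchanging them is an automorphism of the power graph of \<open>G\<close>.\<close>

lemma identity_preserving_isomorphism:
  assumes "group G" "group H" and f: "bij_betw f (carrier G) (carrier H)"
    and cmp: "\<And>x y. x \<in> carrier G \<Longrightarrow> y \<in> carrier G \<Longrightarrow> comparable H (f x) (f y) \<longleftrightarrow> comparable G x y"
  obtains f' where "bij_betw f' (carrier G) (carrier H)" "f' \<one>\<^bsub>G\<^esub> = \<one>\<^bsub>H\<^esub>"
    "\<And>x y. x \<in> carrier G \<Longrightarrow> y \<in> carrier G \<Longrightarrow> comparable H (f' x) (f' y) \<longleftrightarrow> comparable G x y"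
proof -
  interpret G: group G by (rule assms(1))
  interpret H: group H by (rule assms(2))
  obtain d where d: "d \<in> carrier G" "f d = \<one>\<^bsub>H\<^esub>"
    using bij_betw_imp_surj_on[OF f] H.one_closed by (metis imageE)
  define \<tau> where "\<tau> = id(\<one>\<^bsub>G\<^esub> := d, d := \<one>\<^bsub>G\<^esub>)"
  have "bij_betw \<tau> (carrier G) (carrier G)"
    by (rule bij_betw_byWitness[where f' = \<tau>]) (use d in \<open>auto simp: \<tau>_def\<close>)
  then have "bij_betw (f \<circ> \<tau>) (carrier G) (carrier H)" using f by (rule bij_betw_trans)
  moreover have "(f \<circ> \<tau>) \<one>\<^bsub>G\<^esub> = \<one>\<^bsub>H\<^esub>" using d by (auto simp: \<tau>_def)
  moreover have "comparable H ((f \<circ> \<tau>) x) ((f \<circ> \<tau>) y) \<longleftrightarrow> comparable G x y"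
    if xy: "x \<in> carrier G" "y \<in> carrier G" for x y
  proof -
    have "comparable H (f d) (f z)" for z
      unfolding d(2) comparable_def by simp
    then have dom: "comparable G d z" "comparable G z d" "comparable G \<one>\<^bsub>G\<^esub> z" "comparable G z \<one>\<^bsub>G\<^esub>"
      if "z \<in> carrier G" for z
      using cmp[OF d(1) that] comparable_commute[of G z d] by (auto simp: comparable_def)
    have "comparable G (\<tau> x) (\<tau> y) \<longleftrightarrow> comparable G x y"
      using dom xy d by (auto simp: \<tau>_def)
    moreover have "\<tau> x \<in> carrier G" "\<tau> y \<in> carrier G" using xy d by (auto simp: \<tau>_def)
    ultimately show ?thesis using cmp by simp
  qed
  ultimately show thesis by (rule that)
qed

theorem corollary3p9:
  fixes G :: "('a, 'm) monoid_scheme" and H :: "('b, 'n) monoid_scheme"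
  assumes "group G" and "torsion_free G" and "group H"
    and "digraph_iso (with_proj (power_graph G)) (with_proj (power_graph H))"
  shows "digraph_iso (with_proj (directed_power_graph G)) (with_proj (directed_power_graph H))"
proof -
  obtain f where f: "bij_betw f (pverts (power_graph G)) (pverts (power_graph H))"
    and arcs: "\<forall>x \<in> pverts (power_graph G). \<forall>y \<in> pverts (power_graph G).
      (x, y) \<in> parcs (power_graph G) \<longleftrightarrow> (f x, f y) \<in> parcs (power_graph H)"
    using assms(4) unfolding digraph_iso_with_proj_iff[OF wf_power_graph wf_power_graph] by auto
  have verts: "pverts (power_graph G) = carrier G" "pverts (power_graph H) = carrier H"
    by (simp_all add: power_graph_def)
  have bij: "bij_betw f (carrier G) (carrier H)" using f verts by simp
  have "comparable H (f x) (f y) \<longleftrightarrow> comparable G x y" if xy: "x \<in> carrier G" "y \<in> carrier G" for x y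
  proof (cases "x = y")
    case True
    then show ?thesis
      using xy bij_betwE[OF bij] group.generates_refl assms(1,3) unfolding comparable_def by metis
  next
    case False
    then have "f x \<noteq> f y" using bij xy by (auto simp: bij_betw_def inj_on_def)
    then show ?thesis
      using arcs[unfolded verts, rule_format, OF xy] xy bij_betwE[OF bij] False
      by (simp add: arc_power_graph)
  qed
  then obtain f' where f': "bij_betw f' (carrier G) (carrier H)" "f' \<one>\<^bsub>G\<^esub> = \<one>\<^bsub>H\<^esub>"
    "\<And>x y. x \<in> carrier G \<Longrightarrow> y \<in> carrier G \<Longrightarrow> comparable H (f' x) (f' y) \<longleftrightarrow> comparable G x y"
    using identity_preserving_isomorphism[OF assms(1,3) bij] by metis
  interpret power_graph_isomorphism G H f'
    using assms(1,3) f' torsion_free_infinite_order[OF assms(1,2)]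
    by (intro power_graph_isomorphism.intro power_graph_isomorphism_axioms.intro)
  obtain g where g: "bij_betw g (carrier G) (carrier H)"
    and gen: "\<forall>x \<in> carrier G. \<forall>z \<in> carrier G. generates H (g x) (g z) \<longleftrightarrow> generates G x z"
    using directed_isomorphism_exists by blast
  have dverts: "pverts (directed_power_graph G) = carrier G"
    "pverts (directed_power_graph H) = carrier H"
    by (simp_all add: directed_power_graph_def)
  have "(x, y) \<in> parcs (directed_power_graph G) \<longleftrightarrow> (g x, g y) \<in> parcs (directed_power_graph H)"
    if "x \<in> carrier G" "y \<in> carrier G" for x y
    using that gen bij_betwE[OF g] inj_on_eq_iff[OF bij_betw_imp_inj_on[OF g]]
    by (simp add: arc_directed_power_graph)
  then show ?thesis
    unfolding digraph_iso_with_proj_iff[OF wf_directed_power_graph wf_directed_power_graph] dverts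
    using g by blast
qed

end
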